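(* Let $(X,d)$ be a complete and separable metric space and $I=[0,1]$. Given $u\in L^1(I:X)$, the following are equivalent: (1) $u$ is a BV-curve; (2) the difference quotient $\Delta_hu(t):=d(u(t+h),u(t))/h$, $h\in(0,1)$, satisfies $$\sup_{0<h<1}\int_0^{1-h}\Delta_hu(t)\,\mathrm dt<\infty;$$ (3) there is a finite Borel measure $\mu\in\mathcal M([0,1])$ such that for any $\varphi\in\mathrm{Lip}_1(X:\mathbb R)$, $\varphi\circ u$ is a BV-function and $|D(\varphi\circ u)|\le\mu$; (4) there is a finite Borel measure $\mu\in\mathcal M([0,1])$ such that for any $\varphi=d(\cdot,x)$ with $x\in X$, $\varphi\circ u$ is a BV-function and $|D(\varphi\circ u)|\le\mu$; (5) there exists a finite Borel measure $\mu\in\mathcal M([0,1])$ such that for $\mathcal L^2$-a.e. $(s,t)\in I^2$ $$d(u(t),u(s))\le\mu([s,t]),$$ where $[s,t]$ denotes the closed interval with endpoints $s$ and $t$.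
   Context: $\mathcal L^n$ is $n$-dimensional Lebesgue measure; $\mathcal M([0,1])$ is the set of positive measures on $[0,1]$; $\mathrm{Lip}_1(X:\mathbb R)$ is the set of $1$-Lipschitz functions $X\to\mathbb R$. For a complete separable metric space $Y$ ($Y=X$ or $Y=\mathbb R$), $L^1(I:Y)$ is the space of (measurable) maps $u:I\to Y$ with $\int_Id(u(t),\bar y)\,dt<\infty$ for some (every) $\bar y\in Y$. For $J\subset I$, $\mathrm{Var}(u;J)=\sup\{\sum_{i=0}^kd(u(t_i),u(t_{i+1})):t_0<\dots<t_{k+1},\ t_j\in J\}$ and $\mathrm{ess\,Var}(u;J)=\inf\{\mathrm{Var}(v;J):v=u\text{ a.e. on }J\}$. A map $u\in L^1(I:Y)$ is a BV-curve (BV-function if $Y=\mathbb R$) if $\mathrm{ess\,Var}(u;I)<\infty$. Its variation measure $|Du|$ is the Lebesgue–Stieltjes measure on $I$ induced by the non-decreasing function $V(t)=\mathrm{ess\,Var}(u;(0,t))$, i.e. $|Du|((a,b))=V(b^-)-V(a^+)$ (no mass at $\{0\}$ and $\{1\}$). *)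

theory Defs
  imports "HOL-Analysis.Analysis"
begin

text \<open>Throughout, \<open>I = [0,1]\<close>. Maps on \<open>I\<close> are represented by total functions on the reals, whose
  values outside \<open>I\<close> never matter.\<close>

definition L1_I :: "(real \<Rightarrow> 'a::polish_space) set" where
  "L1_I = {u. u \<in> lebesgue_on {0..1} \<rightarrow>\<^sub>M borel \<and>
              (\<exists>y. (\<integral>\<^sup>+ t. ennreal (dist (u t) y) \<partial>lebesgue_on {0..1}) < \<infinity>)}"

definition Var :: "(real \<Rightarrow> 'a::metric_space) \<Rightarrow> real set \<Rightarrow> ennreal" where
  "Var u J = Sup {ennreal (\<Sum>i=0..k. dist (u (t i)) (u (t (Suc i)))) | (t :: nat \<Rightarrow> real) k.
                    (\<forall>i\<le>k. t i < t (Suc i)) \<and> (\<forall>i\<le>Suc k. t i \<in> J)}"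

definition ess_Var :: "(real \<Rightarrow> 'a::metric_space) \<Rightarrow> real set \<Rightarrow> ennreal" where
  "ess_Var u J = Inf {Var v J | v. AE t in lebesgue. t \<in> J \<longrightarrow> v t = u t}"

text \<open>For \<open>'a = real\<close> these are the BV-functions.\<close>

definition BV_curve :: "(real \<Rightarrow> 'a::polish_space) \<Rightarrow> bool" where
  "BV_curve u \<longleftrightarrow> u \<in> L1_I \<and> ess_Var u {0..1} < \<infinity>"

text \<open>Real-valued since it is only used for BV-curves, where the essential variation is finite.\<close>

definition variation_fun :: "(real \<Rightarrow> 'a::metric_space) \<Rightarrow> real \<Rightarrow> real" where
  "variation_fun u t = enn2real (ess_Var u {0<..<t})"

text \<open>The library constructs the Lebesgue--Stieltjes measure of a non-decreasing,
  right-continuous function on the whole line, with \<open>F b - F a\<close> as the mass of \<open>(a,b]\<close>. So \<open>V\<close> on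
  \<open>(0,1)\<close> is replaced by its right limits and extended by constants in such a way that neither
  \<open>0\<close> nor \<open>1\<close> becomes a jump. Lemma \<open>emeasure_variation_measure_Ioo\<close> below is the resulting
  formula \<open>|Du|((a,b)) = V(b-) - V(a+)\<close>.\<close>

definition right_cont_ext :: "(real \<Rightarrow> real) \<Rightarrow> real \<Rightarrow> real" where
  "right_cont_ext V t =
     (if t < 0 then Lim (at_right 0) V
      else if t < 1 then Lim (at_right t) V
      else Lim (at_left 1) V)"

definition variation_measure :: "(real \<Rightarrow> 'a::metric_space) \<Rightarrow> real measure" where
  "variation_measure u =
     restrict_space (interval_measure (right_cont_ext (variation_fun u))) {0..1}"

definition finite_borel_measures_I :: "real measure set" where
  "finite_borel_measures_I = {\<mu>. sets \<mu> = sets (restrict_space borel {0..1}) \<and> finite_measure \<mu>}"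

text \<open>Setwise domination, with both measures on the Borel sets of \<open>[0,1]\<close>.\<close>

definition variation_le :: "(real \<Rightarrow> 'a::metric_space) \<Rightarrow> real measure \<Rightarrow> bool" where
  "variation_le u \<mu> \<longleftrightarrow>
     (\<forall>B\<in>sets (restrict_space borel {0..1}). emeasure (variation_measure u) B \<le> emeasure \<mu> B)"

lemma sets_variation_measure: "sets (variation_measure u) = sets (restrict_space borel {0..1})"
  unfolding variation_measure_def by (rule sets_restrict_space_cong) simp

lemma Var_mono: "A \<subseteq> B \<Longrightarrow> Var u A \<le> Var u B"
  unfolding Var_def by (rule Sup_subset_mono) blast

lemma ess_Var_mono:
  assumes "A \<subseteq> B" shows "ess_Var u A \<le> ess_Var u B"
  unfolding ess_Var_def
proof (rule Inf_mono, safe)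
  fix v assume v: "AE t in lebesgue. t \<in> B \<longrightarrow> v t = u t"
  have "AE t in lebesgue. t \<in> A \<longrightarrow> v t = u t"
    using v assms by (auto elim!: eventually_mono)
  then show "\<exists>a\<in>{Var v A |v. AE t in lebesgue. t \<in> A \<longrightarrow> v t = u t}. a \<le> Var v B"
    using Var_mono[OF assms] by blast
qed

context
  fixes V :: "real \<Rightarrow> real" and C :: real
  assumes V_mono: "\<And>s t. 0 < s \<Longrightarrow> s \<le> t \<Longrightarrow> t < 1 \<Longrightarrow> V s \<le> V t"
    and V_bound: "\<And>t. 0 < t \<Longrightarrow> t < 1 \<Longrightarrow> 0 \<le> V t \<and> V t \<le> C"
begin

lemma V_right:
  assumes "0 \<le> t" "t < 1" shows "(V \<longlongrightarrow> Lim (at_right t) V) (at_right t)"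
proof -
  have "(V \<longlongrightarrow> Inf (V ` ({t<..} \<inter> {t<..<1}))) (at t within ({t<..} \<inter> {t<..<1}))"
    by (rule Lim_right_bound[where K=0]) (use V_mono V_bound assms in auto)
  moreover have "{t<..} \<inter> {t<..<1} = {t<..<1}" by auto
  moreover have "at t within {t<..<1} = at_right t"
    using assms by (intro at_within_nhd[where S="{..<1}"]) auto
  ultimately have "(V \<longlongrightarrow> Inf (V ` {t<..<1})) (at_right t)" by simp
  then show ?thesis by (metis tendsto_Lim trivial_limit_at_right_real)
qed

lemma V_left:
  assumes "0 < t" "t \<le> 1" shows "(V \<longlongrightarrow> Lim (at_left t) V) (at_left t)"
proof -
  have "(V \<longlongrightarrow> Sup (V ` ({..<t} \<inter> {0<..<t}))) (at t within ({..<t} \<inter> {0<..<t}))"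
    by (rule Lim_left_bound[where K=C]) (use V_mono V_bound assms in auto)
  moreover have "{..<t} \<inter> {0<..<t} = {0<..<t}" by auto
  moreover have "at t within {0<..<t} = at_left t"
    using assms by (intro at_within_nhd[where S="{0<..}"]) auto
  ultimately have "(V \<longlongrightarrow> Sup (V ` {0<..<t})) (at_left t)" by simp
  then show ?thesis by (metis tendsto_Lim trivial_limit_at_left_real)
qed

lemma Lim_right_le: 
  assumes "0 \<le> s" "s < t" "t < 1" shows "Lim (at_right s) V \<le> V t"
proof (rule tendsto_upperbound[OF V_right])
  show "\<forall>\<^sub>F x in at_right s. V x \<le> V t"
    using eventually_at_right_real[OF assms(2)]
    by eventually_elim (use assms V_mono in auto)
qed (use assms in auto)

lemma le_Lim_right: 
  assumes "0 < t" "t < 1" shows "V t \<le> Lim (at_right t) V"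
proof (rule tendsto_lowerbound[OF V_right])
  show "\<forall>\<^sub>F x in at_right t. V t \<le> V x"
    using eventually_at_right_real[OF assms(2)]
    by eventually_elim (use assms V_mono in auto)
qed (use assms in auto)

lemma le_Lim_left: 
  assumes "0 < s" "s < t" "t \<le> 1" shows "V s \<le> Lim (at_left t) V"
proof (rule tendsto_lowerbound[OF V_left])
  show "\<forall>\<^sub>F x in at_left t. V s \<le> V x"
    using eventually_at_left_real[OF assms(2)]
    by eventually_elim (use assms V_mono in auto)
qed (use assms in auto)

lemma Lim_right_mono:
  assumes "0 \<le> s" "s \<le> t" "t < 1" shows "Lim (at_right s) V \<le> Lim (at_right t) V"
proof (cases "s = t")
  case False
  with assms have "Lim (at_right s) V \<le> V t" by (intro Lim_right_le) auto
  also have "V t \<le> Lim (at_right t) V" using assms False by (intro le_Lim_right) auto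
  finally show ?thesis .
qed simp

lemma Lim_right_le_Lim_left:
  assumes "0 \<le> s" "s < t" "t \<le> 1" shows "Lim (at_right s) V \<le> Lim (at_left t) V"
proof -
  obtain r where "s < r" "r < t" using assms dense by blast
  with assms have "Lim (at_right s) V \<le> V r" "V r \<le> Lim (at_left t) V"
    by (auto intro!: Lim_right_le le_Lim_left)
  then show ?thesis by simp
qed

lemma right_cont_ext_mono:
  assumes "x \<le> y" shows "right_cont_ext V x \<le> right_cont_ext V y"
  using assms unfolding right_cont_ext_def
  by (auto intro: Lim_right_mono Lim_right_le_Lim_left)

lemma right_cont_ext_right_cont: "continuous (at_right a) (right_cont_ext V)"
proof -
  let ?F = "right_cont_ext V"
  consider "a < 0" | "0 \<le> a" "a < 1" | "1 \<le> a" by linarith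
  then have "(?F \<longlongrightarrow> ?F a) (at_right a)"
  proof cases
    case 1
    have "\<forall>\<^sub>F x in at_right a. ?F a = ?F x"
      using eventually_at_right_real[OF 1]
      by eventually_elim (use 1 in \<open>auto simp: right_cont_ext_def\<close>)
    then show ?thesis by (rule tendsto_eventually[OF eventually_mono]) simp
  next
    case 3
    have "\<forall>\<^sub>F x in at_right a. ?F x = ?F a"
      using eventually_at_right_less[of a]
      by eventually_elim (use 3 in \<open>auto simp: right_cont_ext_def\<close>)
    then show ?thesis by (rule tendsto_eventually)
  next
    case 2
    have Fa: "?F a = Lim (at_right a) V" using 2 by (simp add: right_cont_ext_def)
    show ?thesis
    proof (rule order_tendstoI)
      fix y assume y: "y < ?F a"
      show "\<forall>\<^sub>F x in at_right a. y < ?F x"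
        using eventually_at_right_less[of a]
        by eventually_elim (use y right_cont_ext_mono in \<open>auto intro: less_le_trans less_imp_le\<close>)
    next
      fix y assume "?F a < y"
      then have "\<forall>\<^sub>F x in at_right a. V x < y"
        using order_tendstoD(2)[OF V_right] 2 Fa by auto
      then obtain b where b: "a < b" "\<And>x. a < x \<Longrightarrow> x < b \<Longrightarrow> V x < y"
        unfolding eventually_at_right_field by blast
      let ?c = "min b 1"
      have "a < ?c" using b 2 by auto
      then show "\<forall>\<^sub>F x in at_right a. ?F x < y"
      proof (rule eventually_at_right_real[THEN eventually_mono])
        fix x assume x: "x \<in> {a<..<?c}"
        obtain r where r: "x < r" "r < ?c" using x dense[of x ?c] by auto
        have "?F x = Lim (at_right x) V" using x 2 by (simp add: right_cont_ext_def)
        also have "\<dots> \<le> V r" using x 2 r by (intro Lim_right_le) auto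
        also have "\<dots> < y" using x r b by auto
        finally show "?F x < y" .
      qed
    qed
  qed
  then show ?thesis by (simp add: continuous_within)
qed

lemma right_cont_ext_left_lim:
  assumes "0 < b" "b \<le> 1" shows "(right_cont_ext V \<longlongrightarrow> Lim (at_left b) V) (at_left b)"
proof (rule tendsto_sandwich[OF _ _ V_left[OF assms] tendsto_const])
  show "\<forall>\<^sub>F x in at_left b. V x \<le> right_cont_ext V x"
    using eventually_at_left_real[OF assms(1)]
    by eventually_elim (use assms le_Lim_right in \<open>auto simp: right_cont_ext_def\<close>)
  show "\<forall>\<^sub>F x in at_left b. right_cont_ext V x \<le> Lim (at_left b) V"
    using eventually_at_left_real[OF assms(1)]
    by eventually_elim (use assms Lim_right_le_Lim_left in \<open>auto simp: right_cont_ext_def\<close>)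
qed

lemma emeasure_right_cont_ext_Ioo:
  assumes "0 \<le> a" "a < b" "b \<le> 1"
  shows "emeasure (interval_measure (right_cont_ext V)) {a<..<b} =
           ennreal (Lim (at_left b) V - Lim (at_right a) V)"
proof -
  let ?F = "right_cont_ext V"
  let ?M = "interval_measure ?F"
  obtain r where r: "\<And>n. a < r n" "\<And>n. r n < b" "incseq r" "r \<longlonglongrightarrow> b"
    using ereal_incseq_approx[of "ereal a" "ereal b"] assms(2) by simp metis
  have Fa: "?F a = Lim (at_right a) V" using assms by (simp add: right_cont_ext_def)
  have "(\<lambda>n. emeasure ?M {a<..r n}) \<longlonglongrightarrow> emeasure ?M (\<Union>n. {a<..r n})"
    using r(3) by (intro Lim_emeasure_incseq) (force simp: incseq_def intro: order_trans)+
  moreover have "(\<Union>n. {a<..r n}) = {a<..<b}"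
  proof safe
    fix x n assume "x \<in> {a<..r n}" then show "x \<in> {a<..<b}" using r(2)[of n] by auto
  next
    fix x assume x: "x \<in> {a<..<b}"
    then obtain n where "x < r n"
      using order_tendstoD(1)[OF r(4), of x] by (auto simp: eventually_sequentially)
    with x show "x \<in> (\<Union>n. {a<..r n})" by (auto intro!: exI[of _ n])
  qed
  moreover have "emeasure ?M {a<..r n} = ennreal (?F (r n) - ?F a)" for n
    using r(1)[of n] right_cont_ext_mono right_cont_ext_right_cont
    by (intro emeasure_interval_measure_Ioc) auto
  ultimately have "(\<lambda>n. ennreal (?F (r n) - ?F a)) \<longlonglongrightarrow> emeasure ?M {a<..<b}" by simp
  moreover have "(\<lambda>n. ?F (r n)) \<longlonglongrightarrow> Lim (at_left b) V"
  proof (rule filterlim_compose[OF right_cont_ext_left_lim])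
    show "filterlim r (at_left b) sequentially"
      using r(2,4) by (auto simp: filterlim_at less_imp_neq)
  qed (use assms in auto)
  then have "(\<lambda>n. ennreal (?F (r n) - ?F a)) \<longlonglongrightarrow> ennreal (Lim (at_left b) V - ?F a)"
    by (intro tendsto_ennrealI tendsto_diff tendsto_const)
  ultimately show ?thesis using LIMSEQ_unique Fa by metis
qed

end

lemma emeasure_variation_measure_Ioo:
  assumes "BV_curve u" "0 \<le> a" "a < b" "b \<le> 1"
  shows "emeasure (variation_measure u) {a<..<b} =
           ennreal (Lim (at_left b) (variation_fun u) - Lim (at_right a) (variation_fun u))"
proof -
  have fin: "ess_Var u {0<..<t} < \<infinity>" if "t < 1" for t
  proof (rule le_less_trans)
    show "ess_Var u {0<..<t} \<le> ess_Var u {0..1}"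
      using that by (intro ess_Var_mono) auto
  qed (use assms(1) in \<open>simp add: BV_curve_def\<close>)
  have mono: "variation_fun u s \<le> variation_fun u t" if "s \<le> t" "t < 1" for s t
    unfolding variation_fun_def using that fin by (intro enn2real_mono ess_Var_mono) auto
  have bound: "0 \<le> variation_fun u t \<and> variation_fun u t \<le> enn2real (ess_Var u {0..1})"
    if "t < 1" for t
    unfolding variation_fun_def using that assms(1)
    by (auto simp: BV_curve_def intro!: enn2real_mono ess_Var_mono)
  have "emeasure (variation_measure u) {a<..<b} =
          emeasure (interval_measure (right_cont_ext (variation_fun u))) {a<..<b}"
    unfolding variation_measure_def using assms by (intro emeasure_restrict_space) auto
  also have "\<dots> = ennreal (Lim (at_left b) (variation_fun u) - Lim (at_right a) (variation_fun u))"
    using mono bound assms by (intro emeasure_right_cont_ext_Ioo) auto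
  finally show ?thesis .
qed

end

theory Submission
  imports Defs
begin

text \<open>
  Everything rests on control functions: an increasing bounded \<open>F\<close> with \<open>d (u s) (u t) \<le> F t - F s\<close>
  for \<open>s < t\<close> in a set \<open>G\<close> of full measure. By completeness such a \<open>u\<close> extends from \<open>G\<close> to a map of
  finite variation on \<open>[0,1]\<close>, so having a control function is the same as being a BV-curve.

  (1) \<open>\<Longrightarrow>\<close> (3): \<open>\<phi> \<circ> u\<close> inherits the control function \<open>F\<close>, and the measure \<open>dF\<close> dominates \<open>|D(\<phi> \<circ> u)|\<close>.
  (4) \<open>\<Longrightarrow>\<close> (5): take the supremum of \<open>|d(u s, x) - d(u t, x)| \<le> \<mu>([s,t])\<close> over a countable dense set of \<open>x\<close>.
  (5) \<open>\<Longrightarrow>\<close> (1): compare \<open>s\<close> and \<open>t\<close> through a generic intermediate point that is not an atom of \<open>\<mu>\<close>;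
  this upgrades (5) from almost every pair to every pair in a set of full measure, controlled by \<open>\<mu>([0,t])\<close>.

  (1) \<open>\<Longrightarrow>\<close> (2) integrates \<open>F(t + h) - F(t)\<close>. For the converse, fix \<open>h = 2\<^sup>-\<^sup>n\<close>. Averaging over the
  translates of a grid of step \<open>h\<close>, the triangle inequality bounds \<open>d(u s, u t)\<close> by the increment of a
  function with values in \<open>[0,C]\<close>, up to the mean oscillations of \<open>u\<close> on \<open>h\<close>-neighbourhoods of \<open>s\<close> and
  \<open>t\<close>. By (2) and Tonelli these have integral \<open>O(h)\<close>, which is summable in \<open>n\<close>, so they tend to \<open>0\<close>
  almost everywhere and the variation of \<open>u\<close> on a set of full measure is at most \<open>C\<close>.
\<close>

subsection \<open>Control functions\<close>

lemma Var_upper: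
  assumes "\<And>i. i \<le> k \<Longrightarrow> t i < t (Suc i)" "\<And>i. i \<le> Suc k \<Longrightarrow> t i \<in> J"
  shows "ennreal (\<Sum>i=0..k. dist (u (t i)) (u (t (Suc i)))) \<le> Var u J"
  unfolding Var_def by (rule Sup_upper) (use assms in blast)

lemma Var_least:
  assumes "\<And>t k. (\<And>i. i \<le> k \<Longrightarrow> t i < t (Suc i)) \<Longrightarrow> (\<And>i. i \<le> Suc k \<Longrightarrow> t i \<in> J) \<Longrightarrow>
             ennreal (\<Sum>i=0..k. dist (u (t i)) (u (t (Suc i)))) \<le> C"
  shows "Var u J \<le> C"
  unfolding Var_def by (rule Sup_least) (use assms in blast)

lemma Var_le_control:
  fixes u :: "real \<Rightarrow> 'a::metric_space" and A :: "real \<Rightarrow> real"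
  assumes "\<And>s t. s \<in> J \<Longrightarrow> t \<in> J \<Longrightarrow> s < t \<Longrightarrow> dist (u s) (u t) \<le> A t - A s"
    and "\<And>s t. s \<in> J \<Longrightarrow> t \<in> J \<Longrightarrow> A t - A s \<le> C"
  shows "Var u J \<le> ennreal C"
proof (rule Var_least)
  fix t :: "nat \<Rightarrow> real" and k
  assume t: "\<And>i. i \<le> k \<Longrightarrow> t i < t (Suc i)" "\<And>i. i \<le> Suc k \<Longrightarrow> t i \<in> J"
  have "(\<Sum>i=0..k. dist (u (t i)) (u (t (Suc i)))) \<le> (\<Sum>i=0..k. A (t (Suc i)) - A (t i))"
    by (intro sum_mono assms(1)) (use t in auto)
  also have "\<dots> = A (t (Suc k)) - A (t 0)" by (rule sum_Suc_diff) simp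
  also have "\<dots> \<le> C" using t by (intro assms(2)) auto
  finally show "ennreal (\<Sum>i=0..k. dist (u (t i)) (u (t (Suc i)))) \<le> ennreal C"
    by (rule ennreal_leI)
qed

text \<open>Any partition of \<open>J \<inter> {..p}\<close> can be prolonged by \<open>p\<close>
  and then \<open>q\<close>; the extra term leading to \<open>p\<close> is nonnegative and may be
  dropped.\<close>

lemma Var_add_dist_le:
  fixes u :: "real \<Rightarrow> 'a::metric_space"
  assumes "p \<in> J" "q \<in> J" "p < q"
  shows "Var u (J \<inter> {..p}) + ennreal (dist (u p) (u q)) \<le> Var u (J \<inter> {..q})"
proof -
  let ?V = "Var u (J \<inter> {..q})" and ?c = "ennreal (dist (u p) (u q))"
  \<comment> \<open>Truncated subtraction in \<open>ennreal\<close> is undone by addition only if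
    the subtrahend is at most the minuend; the two-point partition \<open>p\<close>,
    \<open>q\<close> shows this.\<close>
  have c: "?c \<le> ?V"
    using Var_upper[of 0 "\<lambda>i. if i = 0 then p else q" "J \<inter> {..q}" u] assms
    by (auto simp: le_Suc_eq)
  have "Var u (J \<inter> {..p}) \<le> ?V - ?c"
  proof (rule Var_least)
    fix t :: "nat \<Rightarrow> real" and k
    assume t: "\<And>i. i \<le> k \<Longrightarrow> t i < t (Suc i)" "\<And>i. i \<le> Suc k \<Longrightarrow> t i \<in> J \<inter> {..p}"
    let ?S = "\<Sum>i=0..k. dist (u (t i)) (u (t (Suc i)))"
    have "ennreal (?S + dist (u p) (u q)) \<le> ?V"
    \<comment> \<open>Partitions increase strictly, so \<open>p\<close> may be appended only when it
      is not already the last point.\<close>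
    proof (cases "t (Suc k) = p")
      case True
      let ?t = "t(Suc (Suc k) := q)"
      have "ennreal (\<Sum>i=0..Suc k. dist (u (?t i)) (u (?t (Suc i)))) \<le> ?V"
        using t assms True by (intro Var_upper) (force simp: le_Suc_eq)+
      moreover have "(\<Sum>i=0..k. dist (u (?t i)) (u (?t (Suc i)))) = ?S" by (intro sum.cong) auto
      ultimately show ?thesis using True by simp
    next
      case False
      then have less: "t (Suc k) < p" using t(2)[of "Suc k"] by auto
      let ?t = "t(Suc (Suc k) := p, Suc (Suc (Suc k)) := q)"
      have "ennreal (\<Sum>i=0..Suc (Suc k). dist (u (?t i)) (u (?t (Suc i)))) \<le> ?V"
        using t assms less by (intro Var_upper) (force simp: le_Suc_eq)+
      moreover have "(\<Sum>i=0..k. dist (u (?t i)) (u (?t (Suc i)))) = ?S" by (intro sum.cong) auto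
      ultimately have "ennreal (?S + dist (u (t (Suc k))) (u p) + dist (u p) (u q)) \<le> ?V" by simp
      then show ?thesis by (rule order_trans[rotated]) (intro ennreal_leI, simp)
    qed
    then show "ennreal ?S \<le> ?V - ?c"
      by (intro ennreal_le_minus_iff[THEN iffD2] disjI1) (simp_all add: ennreal_plus sum_nonneg)
  qed
  then have "Var u (J \<inter> {..p}) + ?c \<le> ?V - ?c + ?c" by (rule add_right_mono)
  also have "\<dots> = ?V" using c by (rule diff_add_cancel_ennreal)
  finally show ?thesis .
qed

text \<open>The variation accumulated up to \<open>r\<close> is itself a control function;
  finiteness on \<open>J\<close> makes the passage to real values faithful.\<close>

lemma Var_control:
  fixes u :: "real \<Rightarrow> 'a::metric_space"
  assumes fin: "Var u J < \<infinity>"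
  defines "A \<equiv> \<lambda>r. enn2real (Var u (J \<inter> {..r}))"
  shows "\<And>s t. s \<in> J \<Longrightarrow> t \<in> J \<Longrightarrow> s < t \<Longrightarrow> dist (u s) (u t) \<le> A t - A s"
    and "mono A" and "\<And>r. 0 \<le> A r" and "\<And>r. A r \<le> enn2real (Var u J)"
proof -
  have le: "Var u (J \<inter> {..r}) \<le> Var u J" for r by (intro Var_mono) auto
  then have lt: "Var u (J \<inter> {..r}) < \<infinity>" for r using fin by (rule le_less_trans)
  then have A: "ennreal (A r) = Var u (J \<inter> {..r})" for r by (simp add: A_def)
  have A0: "0 \<le> A r" for r by (simp add: A_def)
  then show "0 \<le> A r" for r .
  show "A r \<le> enn2real (Var u J)" for r
    unfolding A_def using le fin by (intro enn2real_mono) auto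
  show "mono A"
    unfolding A_def using lt by (intro monoI enn2real_mono Var_mono) auto
  show "dist (u s) (u t) \<le> A t - A s" if "s \<in> J" "t \<in> J" "s < t" for s t
  proof -
    have "ennreal (A s + dist (u s) (u t)) \<le> ennreal (A t)"
      using Var_add_dist_le[OF that, of u] A0 by (simp add: A)
    then show ?thesis using A0 by (subst (asm) ennreal_le_iff) auto
  qed
qed

section \<open>Extension from a set of full measure to the unit interval\<close>

lemma AE_lebesgue_ex_in_Ioo:
  fixes a b :: real
  assumes "AE t in lebesgue. P t" "a < b"
  shows "\<exists>t\<in>{a<..<b}. P t"
proof (rule ccontr)
  assume "\<not> (\<exists>t\<in>{a<..<b}. P t)"
  then have "AE t in lebesgue. t \<notin> {a<..<b}"
    using assms(1) by (auto elim!: eventually_mono)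
  then have "{a<..<b} \<in> null_sets lebesgue" by (subst AE_iff_null_sets) auto
  then show False using assms(2) by (auto simp: null_sets_def)
qed

lemma ess_Var_le_Var:
  assumes "AE t in lebesgue. t \<in> J \<longrightarrow> v t = u t"
  shows "ess_Var u J \<le> Var v J"
  unfolding ess_Var_def by (rule Inf_lower) (use assms in blast)

text \<open>At a point outside \<open>G\<close> the monotone function \<open>F\<close> has a
  one-sided limit along \<open>G\<close>, so \<open>u\<close> is Cauchy along a sequence in
  \<open>G\<close>. Completeness gives a value there, and the control estimate survives in the
  limit.\<close>

lemma ess_Var_finite:
  fixes u :: "real \<Rightarrow> 'a::complete_space" and F :: "real \<Rightarrow> real"
  assumes full: "AE t in lebesgue. t \<in> {0..1} \<longrightarrow> t \<in> G" and G: "G \<subseteq> {0..1}"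
    and ctrl: "\<And>s t. s \<in> G \<Longrightarrow> t \<in> G \<Longrightarrow> s < t \<Longrightarrow> dist (u s) (u t) \<le> F t - F s"
    and bnd: "\<And>t. t \<in> G \<Longrightarrow> 0 \<le> F t \<and> F t \<le> C"
  shows "ess_Var u {0..1} < \<infinity>"
proof -
  have dense: "\<exists>t\<in>{a<..<b}. t \<in> G" if "0 \<le> a" "a < b" "b \<le> 1" for a b
    using AE_lebesgue_ex_in_Ioo[OF full that(2)] that by force
  have mono: "F s \<le> F t" if "s \<in> G" "t \<in> G" "s \<le> t" for s t
    using ctrl[of s t] that zero_le_dist[of "u s" "u t"] by (cases "s = t") (auto simp del: zero_le_dist)
  have dist_abs: "dist (u s) (u t) \<le> \<bar>F t - F s\<bar>" if "s \<in> G" "t \<in> G" for s t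
    using ctrl[of s t] ctrl[of t s] that by (cases s t rule: linorder_cases) (auto simp: dist_commute)
  \<comment> \<open>The constant sequence at points of \<open>G\<close> makes the extension agree
    with \<open>u\<close> on \<open>G\<close>.\<close>
  have "\<exists>g. (\<forall>n::nat. g n \<in> G) \<and> g \<longlonglongrightarrow> t \<and> convergent (\<lambda>n. F (g n)) \<and> (t \<in> G \<longrightarrow> (\<forall>n. g n = t))"
    if t: "t \<in> {0..1}" for t
  proof (cases "t \<in> G")
    case True
    then show ?thesis by (intro exI[of _ "\<lambda>_. t"]) (auto simp: convergent_const)
  next
    case False
    show ?thesis
    proof (cases "t < 1")
      case True
      \<comment> \<open>Points \<open>t < 1\<close> are approached from the right; the factor
        \<open>1 - t\<close> keeps the window inside the unit interval.\<close>
      have "\<exists>s\<in>{t<..<t + (1 - t) / real (Suc n)}. s \<in> G" for n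
      proof (rule dense)
        have "(1 - t) / real (Suc n) \<le> (1 - t) / 1" using t by (intro divide_left_mono) auto
        then show "t + (1 - t) / real (Suc n) \<le> 1" by simp
      qed (use True t in auto)
      then obtain g where g: "\<And>n. t < g n" "\<And>n. g n < t + (1 - t) / real (Suc n)" "\<And>n. g n \<in> G"
        by (metis greaterThanLessThan_iff)
      have "(\<lambda>n. t + (1 - t) / real (Suc n)) \<longlonglongrightarrow> t + 0"
        by (intro tendsto_add tendsto_const LIMSEQ_Suc lim_const_over_n)
      then have lim0: "(\<lambda>n. t + (1 - t) / real (Suc n)) \<longlonglongrightarrow> t" by simp
      have lim: "g \<longlonglongrightarrow> t"
        by (rule tendsto_sandwich[OF _ _ tendsto_const lim0])
           (simp_all add: less_imp_le[OF g(1)] less_imp_le[OF g(2)] del: of_nat_Suc)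
      have "(F \<longlongrightarrow> Inf (F ` ({t<..} \<inter> G))) (at t within ({t<..} \<inter> G))"
        by (rule Lim_right_bound[where K=0]) (use mono bnd in auto)
      moreover have "filterlim g (at t within ({t<..} \<inter> G)) sequentially"
        unfolding filterlim_at using lim g by (auto intro!: always_eventually simp: less_imp_neq[OF g(1), symmetric])
      ultimately have "(\<lambda>n. F (g n)) \<longlonglongrightarrow> Inf (F ` ({t<..} \<inter> G))" by (rule filterlim_compose)
      then show ?thesis using g lim False by (auto intro!: exI[of _ g] simp: convergent_def)
    next
      case 1: False
      then have "t = 1" using t by auto
      \<comment> \<open>The only remaining point is \<open>t = 1\<close>, which has to be approached
        from the left.\<close>
      have "\<exists>s\<in>{t - 1 / real (Suc n)<..<t}. s \<in> G" for n
        using \<open>t = 1\<close> by (intro dense) (auto simp: divide_simps)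
      then obtain g where g: "\<And>n. g n < t" "\<And>n. t - 1 / real (Suc n) < g n" "\<And>n. g n \<in> G"
        by (metis greaterThanLessThan_iff)
      have "(\<lambda>n. t - 1 / real (Suc n)) \<longlonglongrightarrow> t - 0"
        by (intro tendsto_diff tendsto_const LIMSEQ_Suc lim_const_over_n)
      then have lim0: "(\<lambda>n. t - 1 / real (Suc n)) \<longlonglongrightarrow> t" by simp
      have lim: "g \<longlonglongrightarrow> t"
        by (rule tendsto_sandwich[OF _ _ lim0 tendsto_const])
           (simp_all add: less_imp_le[OF g(1)] less_imp_le[OF g(2)] del: of_nat_Suc)
      have "(F \<longlongrightarrow> Sup (F ` ({..<t} \<inter> G))) (at t within ({..<t} \<inter> G))"
        by (rule Lim_left_bound[where K=C]) (use mono bnd in auto)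
      moreover have "filterlim g (at t within ({..<t} \<inter> G)) sequentially"
        unfolding filterlim_at using lim g by (auto intro!: always_eventually simp: less_imp_neq[OF g(1)])
      ultimately have "(\<lambda>n. F (g n)) \<longlonglongrightarrow> Sup (F ` ({..<t} \<inter> G))" by (rule filterlim_compose)
      then show ?thesis using g lim False by (auto intro!: exI[of _ g] simp: convergent_def)
    qed
  qed
  then obtain g where gG: "\<And>t n. t \<in> {0..1} \<Longrightarrow> g t n \<in> G"
    and gt: "\<And>t. t \<in> {0..1} \<Longrightarrow> g t \<longlonglongrightarrow> t"
    and gF: "\<And>t. t \<in> {0..1} \<Longrightarrow> convergent (\<lambda>n. F (g t n))"
    and gc: "\<And>t n. t \<in> {0..1} \<Longrightarrow> t \<in> G \<Longrightarrow> g t n = t"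
    by metis
  define v where "v t = lim (\<lambda>n. u (g t n))" for t
  define \<Phi> where "\<Phi> t = lim (\<lambda>n. F (g t n))" for t
  have \<Phi>: "(\<lambda>n. F (g t n)) \<longlonglongrightarrow> \<Phi> t" if "t \<in> {0..1}" for t
    using gF[OF that] by (simp add: \<Phi>_def convergent_LIMSEQ_iff)
  have v: "(\<lambda>n. u (g t n)) \<longlonglongrightarrow> v t" if t: "t \<in> {0..1}" for t
  proof -
    have "Cauchy (\<lambda>n. F (g t n))" using gF[OF t] by (rule convergent_Cauchy)
    then have "Cauchy (\<lambda>n. u (g t n))"
      unfolding Cauchy_def dist_real_def
      using dist_abs[OF gG[OF t] gG[OF t]] by (metis abs_minus_commute le_less_trans)
    then show ?thesis by (simp add: v_def Cauchy_convergent convergent_LIMSEQ_iff[symmetric])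
  qed
  have "Var v {0..1} \<le> ennreal C"
  proof (rule Var_le_control[of _ _ \<Phi>])
    fix s t :: real assume st: "s \<in> {0..1}" "t \<in> {0..1}"
    have "\<Phi> t \<le> C"
      by (rule LIMSEQ_le_const2[OF \<Phi>]) (use st gG bnd in auto)
    moreover have "0 \<le> \<Phi> s"
      by (rule LIMSEQ_le_const[OF \<Phi>]) (use st gG bnd in auto)
    ultimately show "\<Phi> t - \<Phi> s \<le> C" by simp
    assume "s < t"
    \<comment> \<open>\<open>g s\<close> may approach \<open>s\<close> from above, so an
      intermediate point \<open>m\<close> is used to separate the two sequences eventually.\<close>
    then obtain m where m: "s < m" "m < t" using dense_order_class.dense[of s t] by blast
    have "\<forall>\<^sub>F n in sequentially. g s n < m" "\<forall>\<^sub>F n in sequentially. m < g t n"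
      using order_tendstoD(2)[OF gt[OF st(1)] m(1)] order_tendstoD(1)[OF gt[OF st(2)] m(2)]
      by simp_all
    then have "\<forall>\<^sub>F n in sequentially. dist (u (g s n)) (u (g t n)) \<le> F (g t n) - F (g s n)"
      by eventually_elim (use gG st in \<open>auto intro!: ctrl\<close>)
    then show "dist (v s) (v t) \<le> \<Phi> t - \<Phi> s"
      by (intro tendsto_le[OF _ tendsto_diff[OF \<Phi> \<Phi>] tendsto_dist[OF v v]]) (use st in auto)
  qed
  moreover have "ess_Var u {0..1} \<le> Var v {0..1}"
  proof (rule ess_Var_le_Var)
    show "AE t in lebesgue. t \<in> {0..1} \<longrightarrow> v t = u t"
      using full
    proof eventually_elim
      case (elim t)
      show ?case
      proof
        assume t: "t \<in> {0..1}"
        with elim have "(\<lambda>n. u (g t n)) \<longlonglongrightarrow> u t" by (simp add: gc)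
        then show "v t = u t" using v[OF t] LIMSEQ_unique by blast
      qed
    qed
  qed
  ultimately have "ess_Var u {0..1} \<le> ennreal C" by (rule order_trans[rotated])
  then show ?thesis by (rule le_less_trans) simp
qed

subsection \<open>Lipschitz images of BV-curves\<close>

text \<open>The Stieltjes measure of the sum of \<open>F\<close> and \<open>G\<close> is the sum of
  their Stieltjes measures, because the two agree on half-open intervals; the part belonging to
  \<open>G\<close> is nonnegative.\<close>

lemma emeasure_interval_measure_le_add:
  fixes F G :: "real \<Rightarrow> real"
  assumes F: "\<And>x y. x \<le> y \<Longrightarrow> F x \<le> F y" "\<And>a. continuous (at_right a) F"
    and G: "\<And>x y. x \<le> y \<Longrightarrow> G x \<le> G y" "\<And>a. continuous (at_right a) G"
    and B: "B \<in> sets borel"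
  shows "emeasure (interval_measure F) B \<le> emeasure (interval_measure (\<lambda>x. F x + G x)) B"
proof -
  let ?F = "interval_measure F" and ?G = "interval_measure G"
  let ?FG = "interval_measure (\<lambda>x. F x + G x)"
  define N where "N = measure_of UNIV (sets borel) (\<lambda>A. emeasure ?F A + emeasure ?G A)"
  have sets_N: "sets N = sets borel"
    unfolding N_def using sets.sigma_sets_eq[of borel] by (simp add: sets_measure_of_conv)
  have N: "emeasure N A = emeasure ?F A + emeasure ?G A" if "A \<in> sets borel" for A
  proof (rule emeasure_measure_of[OF N_def])
    show "countably_additive (sets N) (\<lambda>A. emeasure ?F A + emeasure ?G A)"
      unfolding countably_additive_def sets_N
      by (auto simp: suminf_add[symmetric] suminf_emeasure)
  qed (use that in \<open>auto simp: sets_N positive_def\<close>)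
  have FG: "\<And>x y. x \<le> y \<Longrightarrow> F x + G x \<le> F y + G y"
    "\<And>a. continuous (at_right a) (\<lambda>x. F x + G x)"
    using F G by (auto intro: add_mono continuous_add)
  \<comment> \<open>Half-open intervals are stable under intersection and generate the Borel sets,
    and those from \<open>- real i\<close> to \<open>real i\<close> exhaust the line with finite
    mass. Agreement on them therefore suffices.\<close>
  have "N = ?FG"
  proof (rule measure_eqI_generator_eq)
    let ?E = "range (\<lambda>(a, b). {a<..b::real})"
    show "Int_stable ?E"
      by (auto simp: Int_stable_def Int_greaterThanAtMost)
    show "sets N = sigma_sets UNIV ?E" "sets ?FG = sigma_sets UNIV ?E"
      using arg_cong[OF borel_sigma_sets_Ioc, of sets] by (simp_all add: sets_N)
    show "emeasure N X = emeasure ?FG X" if "X \<in> ?E" for X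
    proof -
      from that obtain a b where X: "X = {a<..b}" by auto
      then have "X \<in> sets borel" by simp
      have "emeasure N X = ennreal (if a \<le> b then F b - F a else 0) + ennreal (if a \<le> b then G b - G a else 0)"
        using N[OF \<open>X \<in> sets borel\<close>] emeasure_interval_measure_Ioc_eq[OF F, of a b]
          emeasure_interval_measure_Ioc_eq[OF G, of a b] by (simp only: X)
      also have "\<dots> = ennreal (if a \<le> b then F b + G b - (F a + G a) else 0)"
        using F(1)[of a b] G(1)[of a b] by (simp add: algebra_simps flip: ennreal_plus)
      also have "\<dots> = emeasure ?FG X"
        unfolding X by (rule emeasure_interval_measure_Ioc_eq[OF FG, symmetric])
      finally show ?thesis .
    qed
    show "range (\<lambda>i::nat. {- real i<..real i}) \<subseteq> ?E" by auto
    show "(\<Union>i. {- real i<..real i}) = UNIV"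
    proof safe
      fix x :: real
      obtain n where "\<bar>x\<bar> < real n" using reals_Archimedean2 by blast
      then show "x \<in> (\<Union>i. {- real i<..real i})" by (intro UN_I[of n]) auto
    qed auto
    show "emeasure N {- real i<..real i} \<noteq> \<infinity>" for i
      by (simp add: N emeasure_interval_measure_Ioc_eq[OF F] emeasure_interval_measure_Ioc_eq[OF G])
  qed auto
  then show ?thesis using N[OF B] by (metis add_increasing2 order_refl zero_le)
qed

lemma right_cont_ext_add:
  fixes V W :: "real \<Rightarrow> real"
  assumes "\<And>s t. 0 < s \<Longrightarrow> s \<le> t \<Longrightarrow> t < 1 \<Longrightarrow> V s \<le> V t"
    and "\<And>t. 0 < t \<Longrightarrow> t < 1 \<Longrightarrow> 0 \<le> V t \<and> V t \<le> C"
    and "\<And>s t. 0 < s \<Longrightarrow> s \<le> t \<Longrightarrow> t < 1 \<Longrightarrow> W s \<le> W t"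
    and "\<And>t. 0 < t \<Longrightarrow> t < 1 \<Longrightarrow> 0 \<le> W t \<and> W t \<le> D"
  shows "right_cont_ext (\<lambda>t. V t + W t) = (\<lambda>t. right_cont_ext V t + right_cont_ext W t)"
proof -
  have "Lim (at_right t) (\<lambda>t. V t + W t) = Lim (at_right t) V + Lim (at_right t) W"
    if "0 \<le> t" "t < 1" for t
    using V_right[of V C t] V_right[of W D t] assms that
    by (intro tendsto_Lim tendsto_add) (auto simp: trivial_limit_at_right_real)
  moreover have "Lim (at_left 1) (\<lambda>t. V t + W t) = Lim (at_left 1) V + Lim (at_left 1) W"
    using V_left[of V C 1] V_left[of W D 1] assms
    by (intro tendsto_Lim tendsto_add) (auto simp: trivial_limit_at_left_real)
  ultimately show ?thesis by (auto simp: right_cont_ext_def)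
qed

text \<open>The hypothesis on increments makes \<open>W - V\<close> non-decreasing, so
  \<open>W\<close> is the sum of \<open>V\<close> and a function with a Stieltjes measure of its
  own.\<close>

lemma emeasure_right_cont_ext_mono:
  fixes V W :: "real \<Rightarrow> real"
  assumes V: "\<And>s t. 0 < s \<Longrightarrow> s \<le> t \<Longrightarrow> t < 1 \<Longrightarrow> V s \<le> V t"
      "\<And>t. 0 < t \<Longrightarrow> t < 1 \<Longrightarrow> 0 \<le> V t \<and> V t \<le> C"
    and D: "\<And>s t. 0 < s \<Longrightarrow> s \<le> t \<Longrightarrow> t < 1 \<Longrightarrow> V t - V s \<le> W t - W s"
      "\<And>t. 0 < t \<Longrightarrow> t < 1 \<Longrightarrow> V t \<le> W t \<and> W t \<le> C"
    and B: "B \<in> sets borel"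
  shows "emeasure (interval_measure (right_cont_ext V)) B
           \<le> emeasure (interval_measure (right_cont_ext W)) B"
proof -
  let ?G = "\<lambda>t. W t - V t"
  have G: "\<And>s t. 0 < s \<Longrightarrow> s \<le> t \<Longrightarrow> t < 1 \<Longrightarrow> ?G s \<le> ?G t"
      "\<And>t. 0 < t \<Longrightarrow> t < 1 \<Longrightarrow> 0 \<le> ?G t \<and> ?G t \<le> C"
    using V D by (fastforce simp: algebra_simps)+
  have "right_cont_ext W = right_cont_ext (\<lambda>t. V t + ?G t)" by simp
  also have "\<dots> = (\<lambda>t. right_cont_ext V t + right_cont_ext ?G t)"
    by (rule right_cont_ext_add[OF V G])
  finally show ?thesis
    using emeasure_interval_measure_le_add[OF right_cont_ext_mono[OF V]
        right_cont_ext_right_cont[OF V] right_cont_ext_mono[OF G] right_cont_ext_right_cont[OF G] B]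
    by simp
qed

section \<open>Variation measures bounded by control functions\<close>

text \<open>A nearly optimal representative on \<open>{0<..<s}\<close> is continued by
  \<open>v\<close> after a point where both agree. They agree only almost everywhere, so this point
  is sought in \<open>{r<..<s}\<close>; the overlap is the reason for \<open>F r\<close> in place of
  \<open>F s\<close>.\<close>

lemma ess_Var_glue:
  fixes w v :: "real \<Rightarrow> 'a::metric_space" and F :: "real \<Rightarrow> real"
  assumes vw: "AE r in lebesgue. r \<in> {0..1} \<longrightarrow> v r = w r"
    and ctrl: "\<And>p q. p \<in> {0..1} \<Longrightarrow> q \<in> {0..1} \<Longrightarrow> p < q \<Longrightarrow> dist (v p) (v q) \<le> F q - F p"
    and r: "0 < r" "r < s" "s \<le> t" "t \<le> 1"
    and M: "\<And>q. q \<in> {0<..<t} \<Longrightarrow> F q \<le> M"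
  shows "ess_Var w {0<..<t} \<le> ess_Var w {0<..<s} + ennreal (M - F r)"
proof (rule ennreal_le_epsilon)
  have mono: "F p \<le> F q" if "p \<in> {0..1}" "q \<in> {0..1}" "p \<le> q" for p q
    using ctrl[of p q] that zero_le_dist[of "v p" "v q"] by (cases "p = q") (auto simp del: zero_le_dist)
  fix e :: real
  assume fin: "ess_Var w {0<..<s} + ennreal (M - F r) < top" and "0 < e"
  then obtain a where a: "ess_Var w {0<..<s} = ennreal a" "0 \<le> a"
    by (cases "ess_Var w {0<..<s}") auto
  have "ess_Var w {0<..<s} < ennreal (a + e)" using a \<open>0 < e\<close> by (simp add: ennreal_less_iff)
  then obtain w' where w': "AE r in lebesgue. r \<in> {0<..<s} \<longrightarrow> w' r = w r"
    and Var_w': "Var w' {0<..<s} < ennreal (a + e)"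
    unfolding ess_Var_def by (auto simp: Inf_less_iff)
  have fin': "Var w' {0<..<s} < \<infinity>" using Var_w' by (rule less_trans) simp
  have le: "enn2real (Var w' {0<..<s}) \<le> a + e"
    using enn2real_mono[OF less_imp_le[OF Var_w']] a \<open>0 < e\<close> by (simp del: ennreal_plus)
  have "AE r in lebesgue. r \<in> {0<..<s} \<longrightarrow> w' r = v r"
    using vw w' by eventually_elim (use r in auto)
  then obtain p where p: "r < p" "p < s" "w' p = v p"
    using AE_lebesgue_ex_in_Ioo[of _ r s] r by force
  define A where "A q = enn2real (Var w' ({0<..<s} \<inter> {..q}))" for q
  note A = Var_control[OF fin', folded A_def]
  define x where "x q = (if q \<le> p then w' q else v q)" for q
  \<comment> \<open>The glued map is controlled by the cumulative variation of \<open>w'\<close> up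
    to \<open>p\<close>, continued by the increments of \<open>F\<close> beyond
    \<open>p\<close>.\<close>
  let ?B = "\<lambda>q. if q \<le> p then A q else A p + F q - F p"
  have "AE q in lebesgue. q \<in> {0<..<t} \<longrightarrow> x q = w q"
    using vw w' by eventually_elim (use r p in \<open>auto simp: x_def\<close>)
  then have "ess_Var w {0<..<t} \<le> Var x {0<..<t}" by (rule ess_Var_le_Var)
  also have "\<dots> \<le> ennreal (a + e + (M - F r))"
  proof (rule Var_le_control[where A="?B"])
    fix q q' assume q: "q \<in> {0<..<t}" "q' \<in> {0<..<t}"
    have "F r \<le> F p" using p r by (intro mono) auto
    moreover have "F r \<le> M" using r by (intro M) auto
    moreover have "F q' \<le> M" using q by (intro M) auto
    moreover have "F p \<le> F q" if "p < q" using that p q r by (intro mono) auto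
    ultimately show "?B q' - ?B q \<le> a + e + (M - F r)"
      using A(3)[of q] A(3)[of p] A(4)[of q'] A(4)[of p] le a \<open>0 < e\<close> by (auto split: if_splits)
    assume qq: "q < q'"
    consider "q' \<le> p" | "p < q" | "q \<le> p" "p < q'" using qq by linarith
    then show "dist (x q) (x q') \<le> ?B q' - ?B q"
    proof cases
      case 1
      then show ?thesis using A(1)[of q q'] q qq p r by (auto simp: x_def)
    next
      case 2
      then show ?thesis using ctrl[of q q'] q qq p r by (auto simp: x_def)
    next
      case 3
      \<comment> \<open>Across the switch the triangle inequality passes through the common value
        \<open>w' p = v p\<close>.\<close>
      have "dist (w' q) (w' p) \<le> A p - A q" using A(1)[of q p] 3 q p r by (cases "q = p") auto
      moreover have "dist (v p) (v q') \<le> F q' - F p" using 3 q p r by (intro ctrl) auto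
      moreover have "dist (w' q) (v q') \<le> dist (w' q) (w' p) + dist (v p) (v q')"
        using p dist_triangle by metis
      ultimately show ?thesis using 3 by (simp add: x_def)
    qed
  qed
  also have "\<dots> = ess_Var w {0<..<s} + ennreal (M - F r) + ennreal e"
  proof -
    have "F r \<le> M" using r by (intro M) auto
    then show ?thesis using a \<open>0 < e\<close> by (simp add: ac_simps)
  qed
  finally show "ess_Var w {0<..<t} \<le> ess_Var w {0<..<s} + ennreal (M - F r) + ennreal e" .
qed

text \<open>Essential variation on the open interval \<open>{0<..<t}\<close> does not see a jump of
  \<open>F\<close> at \<open>t\<close>, so \<open>F\<close> is replaced by its left limit, the
  supremum over \<open>{0..<t}\<close>. Values and increments of \<open>variation_fun w\<close> both
  lie below those of this function, which lets the Stieltjes measures be compared.\<close>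

lemma emeasure_variation_measure_le:
  fixes w v :: "real \<Rightarrow> 'a::metric_space" and F :: "real \<Rightarrow> real"
  assumes vw: "AE r in lebesgue. r \<in> {0..1} \<longrightarrow> v r = w r"
    and ctrl: "\<And>p q. p \<in> {0..1} \<Longrightarrow> q \<in> {0..1} \<Longrightarrow> p < q \<Longrightarrow> dist (v p) (v q) \<le> F q - F p"
    and F: "mono F" "\<And>t. 0 \<le> F t" "\<And>t. F t \<le> C"
    and B: "B \<in> sets (restrict_space borel {0..1})"
  shows "emeasure (variation_measure w) B
    \<le> emeasure (restrict_space (interval_measure (right_cont_ext (\<lambda>t. SUP s\<in>{0..<t}. F s))) {0..1}) B"
proof -
  let ?W = "\<lambda>t. SUP s\<in>{0..<t}. F s"
  have bdd: "bdd_above (F ` {0..<t})" for t using F by (auto intro!: bdd_aboveI2[where M=C])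
  have FW: "F q \<le> ?W t" if "q \<in> {0..<t}" for q t
    using that bdd by (intro cSUP_upper)
  have WC: "?W t \<le> C" if "0 < t" for t using that F by (intro cSUP_least) auto
  have W0: "0 \<le> ?W t" if "0 < t" for t using FW[of 0 t] F(2)[of 0] that by auto
  have Wm: "?W s \<le> ?W t" if "0 < s" "s \<le> t" for s t
    using that bdd by (intro cSUP_subset_mono) auto
  have le_W: "ess_Var w {0<..<t} \<le> ennreal (?W t)" if "0 < t" "t \<le> 1" for t
  proof -
    have "ess_Var w {0<..<t} \<le> Var v {0<..<t}"
      using vw by (intro ess_Var_le_Var) (use that in \<open>auto elim!: eventually_mono\<close>)
    also have "\<dots> \<le> ennreal (?W t)"
    proof (rule Var_le_control)
      fix p q assume pq: "p \<in> {0<..<t}" "q \<in> {0<..<t}"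
      then show "F q - F p \<le> ?W t" using FW[of q t] F(2)[of p] by auto
      show "dist (v p) (v q) \<le> F q - F p" if "p < q"
        using pq that \<open>t \<le> 1\<close> by (intro ctrl) auto
    qed
    finally show ?thesis .
  qed
  have V: "ess_Var w {0<..<t} = ennreal (variation_fun w t)" if "0 < t" "t \<le> 1" for t
    using le_less_trans[OF le_W[OF that] ennreal_less_top] by (simp add: variation_fun_def)
  have V0: "0 \<le> variation_fun w t" for t by (simp add: variation_fun_def)
  have VW: "variation_fun w t \<le> ?W t" if "0 < t" "t \<le> 1" for t
    using le_W[OF that] V[OF that] W0[OF that(1)] by simp
  have diff: "variation_fun w t - variation_fun w s \<le> ?W t - ?W s" if "0 < s" "s \<le> t" "t < 1" for s t
  proof -
    \<comment> \<open>Gluing with the overlap \<open>{r<..<s}\<close> yields the bound with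
      \<open>F r\<close>; the supremum over \<open>r < s\<close> then turns \<open>F r\<close> into
      \<open>?W s\<close>.\<close>
    have *: "variation_fun w t \<le> variation_fun w s + ?W t - F r" if r: "0 < r" "r < s" for r
    proof -
      have "ess_Var w {0<..<t} \<le> ess_Var w {0<..<s} + ennreal (?W t - F r)"
        by (rule ess_Var_glue[OF vw ctrl]) (use r \<open>s \<le> t\<close> \<open>t < 1\<close> in \<open>auto intro!: FW\<close>)
      moreover have "0 \<le> ?W t - F r" using FW[of r t] r \<open>s \<le> t\<close> by auto
      ultimately have "ennreal (variation_fun w t) \<le> ennreal (variation_fun w s + (?W t - F r))"
        using V[of t] V[of s] \<open>0 < s\<close> \<open>s \<le> t\<close> \<open>t < 1\<close> V0 by simp
      then show ?thesis using V0[of s] \<open>0 \<le> ?W t - F r\<close> by (subst (asm) ennreal_le_iff) auto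
    qed
    have "?W s \<le> variation_fun w s + ?W t - variation_fun w t"
    proof (rule cSUP_least)
      fix q assume q: "q \<in> {0..<s}"
      then obtain r where "q < r" "r < s" using dense[of q s] by auto
      then show "F q \<le> variation_fun w s + ?W t - variation_fun w t"
        using *[of r] monoD[OF F(1), of q r] q by auto
    qed (use \<open>0 < s\<close> in auto)
    then show ?thesis by simp
  qed
  have Vm: "variation_fun w s \<le> variation_fun w t" if "0 < s" "s \<le> t" "t < 1" for s t
    unfolding variation_fun_def using that le_less_trans[OF le_W[of t] ennreal_less_top]
    by (intro enn2real_mono ess_Var_mono) auto
  have VC: "variation_fun w t \<le> C" if "0 < t" "t < 1" for t
    using VW[of t] WC[of t] that by linarith
  obtain B': "B \<in> sets borel" "B \<subseteq> {0..1}" using B by (auto simp: sets_restrict_space_iff)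
  have "emeasure (interval_measure (right_cont_ext (variation_fun w))) B
      \<le> emeasure (interval_measure (right_cont_ext ?W)) B"
    using Vm V0 VW VC WC diff B'(1)
    by (intro emeasure_right_cont_ext_mono[where C=C]) auto
  then show ?thesis
    unfolding variation_measure_def using B' by (simp add: emeasure_restrict_space)
qed

lemma right_cont_ext_finite_borel_measure:
  fixes V :: "real \<Rightarrow> real"
  assumes V: "\<And>s t. 0 < s \<Longrightarrow> s \<le> t \<Longrightarrow> t < 1 \<Longrightarrow> V s \<le> V t"
      "\<And>t. 0 < t \<Longrightarrow> t < 1 \<Longrightarrow> 0 \<le> V t \<and> V t \<le> C"
  shows "restrict_space (interval_measure (right_cont_ext V)) {0..1} \<in> finite_borel_measures_I"
proof -
  let ?M = "interval_measure (right_cont_ext V)"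
  \<comment> \<open>Stieltjes masses are explicit on half-open intervals, and the left end
    \<open>-1\<close> makes room for the point \<open>0\<close>.\<close>
  have "emeasure ?M {0..1} \<le> emeasure ?M {-1<..1}" by (intro emeasure_mono) auto
  also have "\<dots> = ennreal (right_cont_ext V 1 - right_cont_ext V (-1))"
    by (intro emeasure_interval_measure_Ioc right_cont_ext_mono[OF V] right_cont_ext_right_cont[OF V])
      auto
  finally have "emeasure ?M {0..1} < \<infinity>" by (rule le_less_trans) simp
  then have "finite_measure (restrict_space ?M {0..1})"
    by (intro finite_measureI) (simp add: emeasure_restrict_space space_restrict_space)
  moreover have "sets (restrict_space ?M {0..1}) = sets (restrict_space borel {0..1})"
    by (rule sets_restrict_space_cong) simp
  ultimately show ?thesis by (simp add: finite_borel_measures_I_def)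
qed

section \<open>One dominating measure for all Lipschitz images\<close>

lemma L1_I_compose_lipschitz:
  assumes u: "u \<in> L1_I" and \<phi>: "1-lipschitz_on UNIV \<phi>"
  shows "\<phi> \<circ> u \<in> L1_I"
proof -
  from u obtain y where meas: "u \<in> lebesgue_on {0..1} \<rightarrow>\<^sub>M borel"
    and y: "(\<integral>\<^sup>+ t. ennreal (dist (u t) y) \<partial>lebesgue_on {0..1}) < \<infinity>"
    by (auto simp: L1_I_def)
  have "\<phi> \<in> borel \<rightarrow>\<^sub>M borel"
    by (intro borel_measurable_continuous_onI lipschitz_on_continuous_on[OF \<phi>])
  then have "\<phi> \<circ> u \<in> lebesgue_on {0..1} \<rightarrow>\<^sub>M borel" using meas by (rule measurable_comp[rotated])
  moreover have "(\<integral>\<^sup>+ t. ennreal (dist ((\<phi> \<circ> u) t) (\<phi> y)) \<partial>lebesgue_on {0..1})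
      \<le> (\<integral>\<^sup>+ t. ennreal (dist (u t) y) \<partial>lebesgue_on {0..1})"
    using lipschitz_onD[OF \<phi>] by (intro nn_integral_mono ennreal_leI) auto
  ultimately show ?thesis using y unfolding L1_I_def by (auto intro: le_less_trans)
qed

lemma BV_curve_obtain:
  assumes "BV_curve u"
  obtains v and F :: "real \<Rightarrow> real" and C :: real where "AE r in lebesgue. r \<in> {0..1} \<longrightarrow> v r = u r"
    and "\<And>p q. p \<in> {0..1} \<Longrightarrow> q \<in> {0..1} \<Longrightarrow> p < q \<Longrightarrow> dist (v p) (v q) \<le> F q - F p"
    and "mono F" "\<And>t. 0 \<le> F t" "\<And>t. F t \<le> C"
proof -
  from assms obtain v where v: "AE r in lebesgue. r \<in> {0..1} \<longrightarrow> v r = u r"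
    and fin: "Var v {0..1} < \<infinity>"
    by (auto simp: BV_curve_def ess_Var_def Inf_less_iff)
  show ?thesis using that[OF v Var_control[OF fin]] by blast
qed

text \<open>Composition with a 1-Lipschitz function does not increase distances. Hence one
  \<open>v\<close> and one \<open>F\<close> obtained from \<open>u\<close> serve every
  \<open>\<phi>\<close>, and the measure is built from \<open>F\<close> alone.\<close>

lemma BV_curve_imp_lipschitz_dominated:
  fixes u :: "real \<Rightarrow> 'a::polish_space"
  assumes "BV_curve u"
  shows "\<exists>\<mu>\<in>finite_borel_measures_I. \<forall>\<phi> :: 'a \<Rightarrow> real. 1-lipschitz_on UNIV \<phi> \<longrightarrow>
           BV_curve (\<phi> \<circ> u) \<and> variation_le (\<phi> \<circ> u) \<mu>"
proof -
  from assms obtain v and F :: "real \<Rightarrow> real" and C :: real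
    where v: "AE r in lebesgue. r \<in> {0..1} \<longrightarrow> v r = u r"
    and ctrl: "\<And>p q. p \<in> {0..1} \<Longrightarrow> q \<in> {0..1} \<Longrightarrow> p < q \<Longrightarrow> dist (v p) (v q) \<le> F q - F p"
    and F: "mono F" "\<And>t. 0 \<le> F t" "\<And>t. F t \<le> C"
    by (rule BV_curve_obtain) blast
  let ?\<mu> = "restrict_space (interval_measure (right_cont_ext (\<lambda>t. SUP s\<in>{0..<t}. F s))) {0..1}"
  have bdd: "bdd_above (F ` A)" for A using F by (auto intro!: bdd_aboveI2[where M=C])
  have "BV_curve (\<phi> \<circ> u) \<and> variation_le (\<phi> \<circ> u) ?\<mu>"
    if \<phi>: "1-lipschitz_on UNIV \<phi>" for \<phi> :: "'a \<Rightarrow> real"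
  proof -
    have v\<phi>: "AE r in lebesgue. r \<in> {0..1} \<longrightarrow> (\<phi> \<circ> v) r = (\<phi> \<circ> u) r"
      using v by eventually_elim simp
    have ctrl\<phi>: "dist ((\<phi> \<circ> v) p) ((\<phi> \<circ> v) q) \<le> F q - F p"
      if "p \<in> {0..1}" "q \<in> {0..1}" "p < q" for p q
      using ctrl[OF that] lipschitz_onD[OF \<phi>, of "v p" "v q"] by simp
    have "ess_Var (\<phi> \<circ> u) {0..1} \<le> Var (\<phi> \<circ> v) {0..1}" by (rule ess_Var_le_Var[OF v\<phi>])
    also have "\<dots> \<le> ennreal C"
      by (rule Var_le_control[OF ctrl\<phi>]) (use F in \<open>auto simp: diff_le_eq intro: add_increasing2\<close>)
    finally have "ess_Var (\<phi> \<circ> u) {0..1} < \<infinity>" by (rule le_less_trans) simp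
    then have "BV_curve (\<phi> \<circ> u)"
      using L1_I_compose_lipschitz[OF _ \<phi>] assms by (simp add: BV_curve_def)
    moreover have "variation_le (\<phi> \<circ> u) ?\<mu>"
      unfolding variation_le_def
      by (intro ballI) (rule emeasure_variation_measure_le[OF v\<phi> ctrl\<phi> F])
    ultimately show ?thesis ..
  qed
  moreover have "?\<mu> \<in> finite_borel_measures_I"
  proof (rule right_cont_ext_finite_borel_measure)
    show "(SUP r\<in>{0..<s}. F r) \<le> (SUP r\<in>{0..<t}. F r)" if "0 < s" "s \<le> t" for s t
      using that bdd by (intro cSUP_subset_mono) auto
    show "0 \<le> (SUP r\<in>{0..<t}. F r) \<and> (SUP r\<in>{0..<t}. F r) \<le> C" if "0 < t" for t
      using that F by (auto intro!: cSUP_least cSUP_upper2[OF bdd, of 0])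
  qed
  ultimately show ?thesis by blast
qed

subsection \<open>Domination by a measure implies bounded variation\<close>

lemma AE_lebesgue_fst_snd:
  assumes "AE s in lebesgue. P (s::real)"
  shows "AE x in lebesgue. P (fst x) \<and> P (snd (x :: real \<times> real))"
proof -
  \<comment> \<open>The exceptional set of \<open>P\<close> may fail to be Borel; a Borel null set
    around it makes the set in the product measurable.\<close>
  obtain N where N: "N \<in> null_sets lborel" "{s. \<not> P s} \<subseteq> N"
    using assms unfolding AE_completion_iff by (auto simp: eventually_ae_filter)
  have [simp]: "N \<in> sets borel" using N(1) by (auto simp: null_sets_def)
  have "AE s in lborel. s \<notin> N" using N(1) by (rule AE_not_in)
  then have "AE s in lborel. AE t in lborel. fst (s, t) \<notin> N \<and> snd (s, t) \<notin> N"
    by (auto elim!: eventually_mono)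
  then have "AE x in lborel \<Otimes>\<^sub>M lborel. fst x \<notin> N \<and> snd x \<notin> N"
  proof (rule lborel_pair.AE_pair_measure[rotated])
    have "{x \<in> space (lborel \<Otimes>\<^sub>M lborel). fst x \<notin> N \<and> snd x \<notin> N} = (- N) \<times> (- N)"
      by (auto simp: space_pair_measure)
    also have "\<dots> \<in> sets (lborel \<Otimes>\<^sub>M lborel)" by (intro pair_measureI) (auto simp: borel_comp)
    finally show "{x \<in> space (lborel \<Otimes>\<^sub>M lborel). fst x \<notin> N \<and> snd x \<notin> N}
        \<in> sets (lborel \<Otimes>\<^sub>M lborel)" .
  qed
  then have "AE x in lborel. fst x \<notin> N \<and> snd (x :: real \<times> real) \<notin> N"
    by (simp only: lborel_prod)
  then show ?thesis unfolding AE_completion_iff by eventually_elim (use N(2) in auto)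
qed

lemma AE_lebesgue_Pair:
  assumes "AE x in lebesgue. P (x :: real \<times> real)"
  shows "AE s in lebesgue. AE t in lebesgue. P (s, t)"
  using assms unfolding AE_completion_iff lborel_prod[symmetric] by (rule lborel_pair.AE_pair)

section \<open>Distances bounded by variation measures\<close>

text \<open>The sets \<open>{r n<..t}\<close> with \<open>r n\<close> increasing to \<open>s\<close>
  decrease to \<open>{s..t}\<close>, and finite mass permits continuity from above. This carries
  estimates from half-open intervals, where Stieltjes measures are explicit, to closed ones.\<close>

lemma emeasure_Icc_ge:
  fixes M :: "real measure"
  assumes M: "sets M = sets borel" and a: "a < s" "emeasure M {a<..t} < \<infinity>"
    and c: "\<And>r. a \<le> r \<Longrightarrow> r < s \<Longrightarrow> c \<le> emeasure M {r<..t}"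
  shows "c \<le> emeasure M {s..t}"
proof -
  define r where "r n = s - (s - a) / real (Suc n)" for n
  have "r \<longlonglongrightarrow> s - 0"
    unfolding r_def by (intro tendsto_diff tendsto_const LIMSEQ_Suc lim_const_over_n)
  then have r: "r \<longlonglongrightarrow> s" by simp
  have less: "r n < s" for n using a by (simp add: r_def)
  have "(s - a) / real (Suc n) \<le> (s - a) / 1" for n
    using a by (intro divide_left_mono) auto
  then have ge: "a \<le> r n" for n by (simp add: r_def algebra_simps)
  have "incseq r"
    unfolding r_def using a by (intro incseq_SucI diff_left_mono divide_left_mono) auto
  then have "{r n<..t} \<subseteq> {r m<..t}" if "m \<le> n" for m n
    using incseqD[OF _ that, of r] by auto
  then have "decseq (\<lambda>n. {r n<..t})" by (simp add: decseq_def)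
  moreover have "emeasure M {r n<..t} \<noteq> \<infinity>" for n
    using emeasure_mono[of "{r n<..t}" "{a<..t}" M] ge[of n] a(2) M by (force simp: top_unique)
  ultimately have "(INF n. emeasure M {r n<..t}) = emeasure M (\<Inter>n. {r n<..t})"
    using M by (intro INF_emeasure_decseq) auto
  also have "(\<Inter>n. {r n<..t}) = {s..t}"
  proof (intro equalityI subsetI)
    fix x assume "x \<in> (\<Inter>n. {r n<..t})"
    then show "x \<in> {s..t}" using LIMSEQ_le_const2[OF r, of x] by (auto intro: less_imp_le)
  next
    fix x assume "x \<in> {s..t}"
    then show "x \<in> (\<Inter>n. {r n<..t})" using less by (auto intro: less_le_trans)
  qed
  finally have "(INF n. emeasure M {r n<..t}) = emeasure M {s..t}" .
  moreover have "c \<le> (INF n. emeasure M {r n<..t})" by (intro INF_greatest c ge less)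
  ultimately show ?thesis by simp
qed

lemma BV_curve_variation_fun:
  assumes "BV_curve w"
  shows "\<And>t. t \<le> 1 \<Longrightarrow> ess_Var w {0<..<t} = ennreal (variation_fun w t)"
    and "\<And>s t. s \<le> t \<Longrightarrow> t \<le> 1 \<Longrightarrow> variation_fun w s \<le> variation_fun w t"
    and "\<And>t. 0 \<le> variation_fun w t"
proof -
  have fin: "ess_Var w {0<..<t} < \<infinity>" if "t \<le> 1" for t
  proof (rule le_less_trans)
    show "ess_Var w {0<..<t} \<le> ess_Var w {0..1}" using that by (intro ess_Var_mono) auto
  qed (use assms in \<open>simp add: BV_curve_def\<close>)
  then show "ess_Var w {0<..<t} = ennreal (variation_fun w t)" if "t \<le> 1" for t
    using that by (simp add: variation_fun_def)
  show "variation_fun w s \<le> variation_fun w t" if "s \<le> t" "t \<le> 1" for s t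
    unfolding variation_fun_def using that fin by (intro enn2real_mono ess_Var_mono) auto
  show "0 \<le> variation_fun w t" for t by (simp add: variation_fun_def)
qed

text \<open>A representative whose variation on \<open>{0<..<q}\<close> is within \<open>e\<close>
  of the infimum accumulates at least \<open>variation_fun w s\<close> up to \<open>s\<close>,
  because it also competes in the infimum for \<open>{0<..<s}\<close>. The step from
  \<open>s\<close> to \<open>t\<close> comes on top.\<close>

lemma variation_fun_add_dist_le:
  assumes w: "BV_curve w" and q: "q \<le> 1" and "0 < e"
  shows "\<exists>v. (AE r in lebesgue. r \<in> {0<..<q} \<longrightarrow> v r = w r) \<and>
    (\<forall>s t. 0 < s \<longrightarrow> s < t \<longrightarrow> t < q \<longrightarrow> variation_fun w s + dist (v s) (v t) \<le> variation_fun w q + e)"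
proof -
  note V = BV_curve_variation_fun[OF w]
  have "ess_Var w {0<..<q} < ennreal (variation_fun w q + e)"
    using V(1)[OF q] V(3)[of q] \<open>0 < e\<close> by (simp add: ennreal_less_iff del: ennreal_plus)
  then obtain v where v: "AE r in lebesgue. r \<in> {0<..<q} \<longrightarrow> v r = w r"
    and Var_v: "Var v {0<..<q} < ennreal (variation_fun w q + e)"
    unfolding ess_Var_def by (auto simp: Inf_less_iff)
  have fin: "Var v {0<..<q} < \<infinity>" using Var_v by (rule less_trans) simp
  have le: "enn2real (Var v {0<..<q}) \<le> variation_fun w q + e"
    using enn2real_mono[OF less_imp_le[OF Var_v]] V(3)[of q] \<open>0 < e\<close> by (simp del: ennreal_plus)
  show ?thesis
  proof (intro exI[of _ v] conjI v allI impI)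
    fix s t assume st: "0 < s" "s < t" "t < q"
    have sub: "{0<..<s} \<subseteq> {0<..<q} \<inter> {..s}" using st by auto
    have "ess_Var w {0<..<s} \<le> Var v {0<..<s}"
      using v by (intro ess_Var_le_Var) (use st in \<open>auto elim!: eventually_mono\<close>)
    also have "\<dots> \<le> Var v ({0<..<q} \<inter> {..s})" using sub by (rule Var_mono)
    finally have "variation_fun w s \<le> enn2real (Var v ({0<..<q} \<inter> {..s}))"
      unfolding variation_fun_def
      using le_less_trans[OF Var_mono[of "{0<..<q} \<inter> {..s}" "{0<..<q}" v] fin]
      by (intro enn2real_mono) auto
    moreover have "dist (v s) (v t)
        \<le> enn2real (Var v ({0<..<q} \<inter> {..t})) - enn2real (Var v ({0<..<q} \<inter> {..s}))"
      using st by (intro Var_control(1)[OF fin]) auto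
    ultimately show "variation_fun w s + dist (v s) (v t) \<le> variation_fun w q + e"
      using Var_control(4)[OF fin, of t] le by linarith
  qed
qed

text \<open>Nearly optimal representatives show that \<open>?V s + dist (w s) (w t)\<close> is at
  most the right limit of \<open>?V\<close> at \<open>t\<close>, while the right limit at any
  \<open>r < s\<close> is at most \<open>?V s\<close>. The difference of these limits is the mass of
  \<open>{r<..t}\<close>, and \<open>r\<close> then increases to \<open>s\<close>.\<close>

lemma dist_le_variation_measure:
  fixes w :: "real \<Rightarrow> 'a::polish_space"
  assumes w: "BV_curve w"
  shows "\<exists>G. (AE t in lebesgue. t \<in> G) \<and> (\<forall>s\<in>G. \<forall>t\<in>G. 0 < s \<longrightarrow> s < t \<longrightarrow> t < 1 \<longrightarrow>
           ennreal (dist (w s) (w t)) \<le> emeasure (variation_measure w) {s..t})"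
proof -
  let ?V = "variation_fun w"
  note V = BV_curve_variation_fun[OF w]
  let ?P = "\<lambda>q n v. (AE r in lebesgue. r \<in> {0<..<q} \<longrightarrow> v r = w r) \<and>
      (\<forall>s t. 0 < s \<longrightarrow> s < t \<longrightarrow> t < q \<longrightarrow> ?V s + dist (v s) (v t) \<le> ?V q + 1 / real (Suc n))"
  define v where "v q n = (SOME v. ?P q n v)" for q n
  have P: "?P q n (v q n)" if "q \<le> 1" for q n
    unfolding v_def
    by (rule someI_ex[of "?P q n"], rule variation_fun_add_dist_le[OF w that]) simp
  then have v: "AE r in lebesgue. r \<in> {0<..<q} \<longrightarrow> v q n r = w r" if "q \<le> 1" for q n
    using that by blast
  have le: "?V s + dist (v q n s) (v q n t) \<le> ?V q + 1 / real (Suc n)"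
    if "q \<le> 1" "0 < s" "s < t" "t < q" for q n s t
    using P[OF that(1), of n] that by blast
  \<comment> \<open>Each representative \<open>v q n\<close> has its own exceptional null set. Only
    rational \<open>q\<close> and natural \<open>n\<close> enter here, so the union of these sets is
    still null.\<close>
  define G where "G = {r. \<forall>q\<in>\<rat> \<inter> {..1}. \<forall>n. r \<in> {0<..<q} \<longrightarrow> v q n r = w r}"
  have "AE r in lebesgue. \<forall>q\<in>\<rat> \<inter> {..1}. \<forall>n. r \<in> {0<..<q} \<longrightarrow> v q n r = w r"
  proof (rule AE_ball_countable[THEN iffD2, rule_format])
    show "AE r in lebesgue. \<forall>n. r \<in> {0<..<q} \<longrightarrow> v q n r = w r" if "q \<in> \<rat> \<inter> {..1}" for q
      by (rule AE_all_countable[THEN iffD2, rule_format], rule v) (use that in auto)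
  qed (simp add: countable_rat)
  then have "AE r in lebesgue. r \<in> G" by (simp add: G_def)
  moreover have "ennreal (dist (w s) (w t)) \<le> emeasure (variation_measure w) {s..t}"
    if G: "s \<in> G" "t \<in> G" and st: "0 < s" "s < t" "t < 1" for s t
  proof -
    have rat: "?V s + dist (w s) (w t) \<le> ?V q" if q: "q \<in> \<rat>" "t < q" "q < 1" for q
    proof (rule LIMSEQ_le_const)
      have "(\<lambda>n. ?V q + 1 / real (Suc n)) \<longlonglongrightarrow> ?V q + 0"
        by (intro tendsto_add tendsto_const LIMSEQ_Suc lim_const_over_n)
      then show "(\<lambda>n. ?V q + 1 / real (Suc n)) \<longlonglongrightarrow> ?V q" by simp
      show "\<exists>N. \<forall>n\<ge>N. ?V s + dist (w s) (w t) \<le> ?V q + 1 / real (Suc n)"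
      proof (intro exI allI impI)
        fix n
        have "v q n s = w s" "v q n t = w t" using G st q by (auto simp: G_def)
        then show "?V s + dist (w s) (w t) \<le> ?V q + 1 / real (Suc n)"
          using le[of q s t n] st q by simp
      qed
    qed
    have ge: "?V s + dist (w s) (w t) \<le> ?V x" if x: "t < x" "x < 1" for x
    proof -
      obtain q where "q \<in> \<rat>" "t < q" "q < x" using Rats_dense_in_real[OF x(1)] by blast
      then show ?thesis using rat[of q] V(2)[of q x] x by auto
    qed
    have mono: "\<And>s t. 0 < s \<Longrightarrow> s \<le> t \<Longrightarrow> t < 1 \<Longrightarrow> ?V s \<le> ?V t"
      and bnd: "\<And>t. 0 < t \<Longrightarrow> t < 1 \<Longrightarrow> 0 \<le> ?V t \<and> ?V t \<le> ?V 1"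
      using V by auto
    have R: "?V s + dist (w s) (w t) \<le> right_cont_ext ?V t"
    proof -
      have "?V s + dist (w s) (w t) \<le> Lim (at_right t) ?V"
      proof (rule tendsto_lowerbound[OF V_right[OF mono bnd]])
        show "\<forall>\<^sub>F x in at_right t. ?V s + dist (w s) (w t) \<le> ?V x"
          using eventually_at_right_real[OF st(3)] by eventually_elim (use ge in auto)
      qed (use st in auto)
      then show ?thesis using st by (simp add: right_cont_ext_def)
    qed
    let ?M = "interval_measure (right_cont_ext ?V)"
    have Ioc: "emeasure ?M {r<..t} = ennreal (right_cont_ext ?V t - right_cont_ext ?V r)"
      if "r < s" for r
      using that st by (intro emeasure_interval_measure_Ioc right_cont_ext_mono[OF mono bnd]
        right_cont_ext_right_cont[OF mono bnd]) auto
    have "ennreal (dist (w s) (w t)) \<le> emeasure ?M {s..t}"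
    proof (rule emeasure_Icc_ge)
      show "emeasure ?M {0<..t} < \<infinity>" using st by (simp add: Ioc)
      fix r assume r: "0 \<le> r" "r < s"
      have "right_cont_ext ?V r = Lim (at_right r) ?V" using r st by (simp add: right_cont_ext_def)
      also have "\<dots> \<le> ?V s" using r st by (intro Lim_right_le[OF mono bnd]) auto
      finally show "ennreal (dist (w s) (w t)) \<le> emeasure ?M {r<..t}"
        unfolding Ioc[OF r(2)] using R by (intro ennreal_leI) linarith
    qed (use st in auto)
    then show ?thesis
      unfolding variation_measure_def using st by (subst emeasure_restrict_space) auto
  qed
  ultimately show ?thesis by blast
qed

text \<open>For \<open>x\<close> close to \<open>a\<close> the number \<open>dist a x\<close> is
  small and \<open>dist b x\<close> is close to \<open>dist a b\<close>.\<close>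

lemma dist_le_of_dense:
  fixes a b :: "'a::metric_space"
  assumes D: "\<And>X. open X \<Longrightarrow> X \<noteq> {} \<Longrightarrow> \<exists>d\<in>D. d \<in> X"
    and le: "\<And>x. x \<in> D \<Longrightarrow> dist (dist a x) (dist b x) \<le> m"
  shows "dist a b \<le> m"
proof (rule field_le_epsilon)
  fix e :: real assume "0 < e"
  then obtain x where x: "x \<in> D" "dist a x < e / 2"
    using D[of "ball a (e / 2)"] by (auto simp: mem_ball)
  have "dist a b \<le> dist a x + dist b x" by (rule dist_triangle2)
  then show "dist a b \<le> m + e" using le[OF x(1)] x(2) by (auto simp: dist_real_def)
qed

lemma lipschitz_on_dist_left: "1-lipschitz_on UNIV (\<lambda>y. dist y (x::'a::metric_space))"
  by (rule lipschitz_onI) (simp_all add: dist_real_def, metis abs_dist_diff_le dist_commute)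

text \<open>Each \<open>x\<close> brings its own null set, so only a countable dense set of
  \<open>x\<close> is tested. The estimate then holds for all pairs from one set of full measure,
  hence for almost every pair.\<close>

lemma distance_functions_dominated_imp_AE_dist_le:
  fixes u :: "real \<Rightarrow> 'a::polish_space"
  assumes \<mu>: "\<mu> \<in> finite_borel_measures_I"
    and dom: "\<And>x. BV_curve ((\<lambda>y. dist y x) \<circ> u) \<and> variation_le ((\<lambda>y. dist y x) \<circ> u) \<mu>"
  shows "AE (s, t) in lebesgue_on ({0..1} \<times> {0..1}). dist (u t) (u s) \<le> measure \<mu> (closed_segment s t)"
proof -
  interpret finite_measure \<mu> using \<mu> by (simp add: finite_borel_measures_I_def)
  obtain D :: "'a set" where "countable D" and D: "\<And>X. open X \<Longrightarrow> X \<noteq> {} \<Longrightarrow> \<exists>d\<in>D. d \<in> X"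
    using countable_dense_exists by blast
  have "\<exists>G. (AE t in lebesgue. t \<in> G) \<and> (\<forall>s\<in>G. \<forall>t\<in>G. 0 < s \<longrightarrow> s < t \<longrightarrow> t < 1 \<longrightarrow>
      dist (dist (u s) x) (dist (u t) x) \<le> measure \<mu> {s..t})" for x
  proof -
    from dom[of x] obtain G where "AE t in lebesgue. t \<in> G"
      and G: "\<And>s t. s \<in> G \<Longrightarrow> t \<in> G \<Longrightarrow> 0 < s \<Longrightarrow> s < t \<Longrightarrow> t < 1 \<Longrightarrow>
           ennreal (dist (dist (u s) x) (dist (u t) x))
             \<le> emeasure (variation_measure ((\<lambda>y. dist y x) \<circ> u)) {s..t}"
      using dist_le_variation_measure[of "(\<lambda>y. dist y x) \<circ> u"] by auto
    moreover have "dist (dist (u s) x) (dist (u t) x) \<le> measure \<mu> {s..t}"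
      if "s \<in> G" "t \<in> G" "0 < s" "s < t" "t < 1" for s t
    proof -
      have "{s..t} \<in> sets (restrict_space borel {0..1})"
        using that by (auto simp: sets_restrict_space_iff)
      then have "emeasure (variation_measure ((\<lambda>y. dist y x) \<circ> u)) {s..t} \<le> emeasure \<mu> {s..t}"
        using dom[of x] by (simp add: variation_le_def)
      with G[OF that] show ?thesis by (metis emeasure_eq_measure ennreal_le_iff measure_nonneg order_trans)
    qed
    ultimately show ?thesis by blast
  qed
  then obtain G where AE_G: "\<And>x. AE t in lebesgue. t \<in> G x"
    and G: "\<And>x s t. s \<in> G x \<Longrightarrow> t \<in> G x \<Longrightarrow> 0 < s \<Longrightarrow> s < t \<Longrightarrow> t < 1 \<Longrightarrow>
        dist (dist (u s) x) (dist (u t) x) \<le> measure \<mu> {s..t}"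
    by metis
  have less: "dist (u s) (u t) \<le> measure \<mu> {s..t}"
    if "\<forall>x\<in>D. s \<in> G x" "\<forall>x\<in>D. t \<in> G x" "0 < s" "s < t" "t < 1" for s t
    by (rule dist_le_of_dense[OF D]) (use that G in auto)
  have good: "dist (u t) (u s) \<le> measure \<mu> (closed_segment s t)"
    if "\<forall>x\<in>D. s \<in> G x" "\<forall>x\<in>D. t \<in> G x" "0 < s" "0 < t" "s < 1" "t < 1" for s t
    using less[of s t] less[of t s] that
    by (cases s t rule: linorder_cases) (auto simp: closed_segment_eq_real_ivl dist_commute)
  \<comment> \<open>The end points are removed because the estimate is available only strictly
    inside the unit interval.\<close>
  have "AE t in lebesgue. (\<forall>x\<in>D. t \<in> G x) \<and> t \<noteq> 0 \<and> t \<noteq> 1"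
  proof (intro AE_conjI)
    show "AE t in lebesgue. \<forall>x\<in>D. t \<in> G x"
      using AE_G \<open>countable D\<close> by (subst AE_ball_countable) auto
    show "AE t in lebesgue. t \<noteq> (0::real)" "AE t in lebesgue. t \<noteq> (1::real)"
      by (simp_all add: AE_completion_iff AE_lborel_singleton)
  qed
  from AE_lebesgue_fst_snd[OF this]
  have "AE x in lebesgue. x \<in> {0..1} \<times> {0..1} \<longrightarrow>
      dist (u (snd x)) (u (fst x)) \<le> measure \<mu> (closed_segment (fst x) (snd x))"
    by eventually_elim (auto intro!: good)
  then show ?thesis
    by (subst AE_restrict_space_iff) (auto simp: borel_closed closed_Times case_prod_beta)
qed

lemma AE_dist_le_imp_BV_curve:
  fixes u :: "real \<Rightarrow> 'a::polish_space"
  assumes u: "u \<in> L1_I" and \<mu>: "\<mu> \<in> finite_borel_measures_I"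
    and ae: "AE (s, t) in lebesgue_on ({0..1} \<times> {0..1}). dist (u t) (u s) \<le> measure \<mu> (closed_segment s t)"
  shows "BV_curve u"
proof -
  interpret finite_measure \<mu> using \<mu> by (simp add: finite_borel_measures_I_def)
  have sets_\<mu>: "A \<in> sets \<mu> \<longleftrightarrow> A \<in> sets borel \<and> A \<subseteq> {0..1}" for A
    using \<mu> by (auto simp: finite_borel_measures_I_def sets_restrict_space_iff)
  let ?F = "\<lambda>t. measure \<mu> {0..t}"
  define good where "good s z \<longleftrightarrow> dist (u z) (u s) \<le> measure \<mu> (closed_segment s z)" for s z
  \<comment> \<open>By Fubini almost every \<open>s\<close> has almost every \<open>z\<close> as a
    good partner. Atoms are excluded so that closed intervals can be joined without counting an end
    point twice.\<close>
  define G where "G = {s \<in> {0..1}. (AE z in lebesgue. z \<in> {0..1} \<longrightarrow> good s z) \<and> measure \<mu> {s} = 0}"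
  have Icc: "measure \<mu> {a..b} = ?F b - ?F a" if "measure \<mu> {a} = 0" "0 \<le> a" "a \<le> b" "b \<le> 1" for a b
  proof -
    have "?F b = measure \<mu> ({0..<a} \<union> {a..b})" using that by (intro arg_cong[where f="measure \<mu>"]) auto
    also have "\<dots> = measure \<mu> {0..<a} + measure \<mu> {a..b}"
      using that by (intro finite_measure_Union) (auto simp: sets_\<mu>)
    finally have b: "?F b = measure \<mu> {0..<a} + measure \<mu> {a..b}" .
    have "?F a = measure \<mu> ({0..<a} \<union> {a})" using that by (intro arg_cong[where f="measure \<mu>"]) auto
    also have "\<dots> = measure \<mu> {0..<a} + measure \<mu> {a}"
      using that by (intro finite_measure_Union) (auto simp: sets_\<mu>)
    finally show ?thesis using b that by simp
  qed
  \<comment> \<open>A finite measure has at most countably many atoms.\<close>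
  have atoms: "AE s in lebesgue. measure \<mu> {s} = 0"
    using AE_not_in[OF countable_imp_null_set_lborel[OF countable_support]]
    by (simp add: AE_completion_iff)
  have "AE x in lebesgue. x \<in> {0..1} \<times> {0..1} \<longrightarrow> good (fst x) (snd x)"
    using ae unfolding good_def by (subst (asm) AE_restrict_space_iff) (auto simp: borel_closed closed_Times case_prod_beta)
  from AE_lebesgue_Pair[OF this]
  have "AE s in lebesgue. s \<in> {0..1} \<longrightarrow> (AE z in lebesgue. z \<in> {0..1} \<longrightarrow> good s z)"
    by (auto elim!: eventually_mono)
  then have "AE s in lebesgue. s \<in> {0..1} \<longrightarrow> s \<in> G"
    using atoms by eventually_elim (auto simp: G_def)
  then have "ess_Var u {0..1} < \<infinity>"
  proof (rule ess_Var_finite)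
    show "G \<subseteq> {0..1}" by (auto simp: G_def)
    show "0 \<le> ?F t \<and> ?F t \<le> measure \<mu> (space \<mu>)" for t by (simp add: bounded_measure)
    fix s t assume st: "s \<in> G" "t \<in> G" "s < t"
    then have "AE z in lebesgue. z \<in> {0..1} \<longrightarrow> good s z" "AE z in lebesgue. z \<in> {0..1} \<longrightarrow> good t z"
      by (auto simp: G_def)
    with atoms have "AE z in lebesgue. z \<in> {0..1} \<longrightarrow> good s z \<and> good t z \<and> measure \<mu> {z} = 0"
      by eventually_elim auto
    \<comment> \<open>The pair \<open>s\<close>, \<open>t\<close> itself may be exceptional, but
      each condition on \<open>z\<close> holds almost everywhere, so some point between them meets
      all of them.\<close>
    then obtain z where z: "s < z" "z < t" "good s z" "good t z" "measure \<mu> {z} = 0"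
      using AE_lebesgue_ex_in_Ioo[of _ s t] st by (force simp: G_def)
    have "dist (u s) (u t) \<le> dist (u z) (u s) + dist (u z) (u t)" by (rule dist_triangle3)
    also have "\<dots> \<le> measure \<mu> {s..z} + measure \<mu> {z..t}"
      using z by (intro add_mono) (auto simp: good_def closed_segment_eq_real_ivl)
    also have "\<dots> = ?F t - ?F s"
      using z st by (subst (1 2) Icc) (auto simp: G_def)
    finally show "dist (u s) (u t) \<le> ?F t - ?F s" .
  qed
  then show ?thesis using u by (simp add: BV_curve_def)
qed

subsection \<open>Difference quotients\<close>

text \<open>The preimage of each set of a countable base is measurable up to a null set; overwriting
  \<open>f\<close> by a constant on the union of these null sets makes all these preimages
  measurable at once.\<close>

lemma completion_ex_borel_measurable_second_countable:
  fixes f :: "'a \<Rightarrow> 'b::second_countable_topology"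
  assumes f: "f \<in> completion M \<rightarrow>\<^sub>M borel"
  shows "\<exists>g \<in> M \<rightarrow>\<^sub>M borel. AE x in M. g x = f x"
proof -
  obtain B :: "'b set set" where B: "countable B" "topological_basis B"
    using ex_countable_basis by blast
  have "\<exists>A N. A \<in> sets M \<and> N \<in> null_sets M \<and> f -` b \<inter> space M - N = A - N" if "b \<in> B" for b
  proof -
    have "f -` b \<inter> space M \<in> sets (completion M)"
      using measurable_sets[OF f, of b] topological_basis_open[OF B(2) that] by simp
    then obtain A S N where "f -` b \<inter> space M = S \<union> N" "N \<subseteq> A" "A \<in> null_sets M" "S \<in> sets M"
      by (rule sets_completionE)
    then show ?thesis by (intro exI[of _ S] exI[of _ A]) auto
  qed
  then obtain A N where A: "\<And>b. b \<in> B \<Longrightarrow> A b \<in> sets M" and N: "\<And>b. b \<in> B \<Longrightarrow> N b \<in> null_sets M"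
    and eq: "\<And>b. b \<in> B \<Longrightarrow> f -` b \<inter> space M - N b = A b - N b"
    by metis
  define Z where "Z = (\<Union>b\<in>B. N b)"
  have Z: "Z \<in> null_sets M" unfolding Z_def using B(1) N by (rule null_sets_UN')
  then have Zs: "Z \<in> sets M" by auto
  define c :: 'b where "c = undefined"
  let ?g = "\<lambda>x. if x \<in> Z then c else f x"
  have "?g \<in> M \<rightarrow>\<^sub>M borel"
  proof (rule measurable_sigma_sets)
    show "sets borel = sigma_sets UNIV B"
      by (subst borel_eq_countable_basis[OF B]) simp
    fix b assume b: "b \<in> B"
    have "?g -` b \<inter> space M = (A b - Z) \<union> (if c \<in> b then Z else {})"
    proof -
      have "x \<in> A b \<longleftrightarrow> f x \<in> b \<and> x \<in> space M" if "x \<notin> Z" for x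
      proof -
        have "x \<notin> N b" using that b by (auto simp: Z_def)
        then show ?thesis using eq[OF b] by blast
      qed
      then show ?thesis using sets.sets_into_space[OF Zs] by (auto split: if_splits)
    qed
    also have "\<dots> \<in> sets M" using A[OF b] Zs by auto
    finally show "?g -` b \<inter> space M \<in> sets M" .
  qed auto
  moreover have "AE x in M. ?g x = f x"
    using AE_not_in[OF Z] by eventually_elim simp
  ultimately show ?thesis by (intro bexI[of _ ?g])
qed

lemma L1_I_borel_representative:
  assumes "u \<in> L1_I"
  obtains v where "v \<in> borel_measurable borel" "AE t in lebesgue. t \<in> {0..1} \<longrightarrow> v t = u t"
proof -
  have "(\<lambda>t. if t \<in> {0..1} then u t else undefined) \<in> lebesgue \<rightarrow>\<^sub>M borel"
    using assms by (subst measurable_restrict_space_iff[symmetric]) (auto simp: L1_I_def)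
  then obtain v where "v \<in> lborel \<rightarrow>\<^sub>M borel"
      "AE t in lborel. v t = (if t \<in> {0..1} then u t else undefined)"
    using completion_ex_borel_measurable_second_countable by blast
  then show ?thesis
    by (intro that[of v]) (auto simp: AE_completion_iff elim!: eventually_mono)
qed

lemma AE_lebesgue_translate:
  assumes "AE t in lebesgue. P (t :: real)"
  shows "AE t in lebesgue. P (t + h)"
proof -
  obtain N where N: "N \<in> null_sets lborel" "{s. \<not> P s} \<subseteq> N"
    using assms unfolding AE_completion_iff by (auto simp: eventually_ae_filter)
  have "AE t in distr lborel borel ((+) h). t \<notin> N"
    unfolding lborel_distr_plus using N(1) by (rule AE_not_in)
  moreover have "{t \<in> space borel. t \<notin> N} \<in> sets borel"
    using N(1) by (auto simp: null_sets_def Compl_eq[symmetric] intro: borel_comp)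
  ultimately have "AE t in lborel. h + t \<notin> N"
    by (subst (asm) AE_distr_iff) auto
  then show ?thesis
    unfolding AE_completion_iff by eventually_elim (use N(2) in \<open>auto simp: add.commute\<close>)
qed

lemma nn_integral_lebesgue_on_eq:
  fixes f :: "real \<Rightarrow> ennreal"
  assumes "S \<in> sets borel"
  shows "(\<integral>\<^sup>+ t. f t \<partial>lebesgue_on S) = (\<integral>\<^sup>+ t\<in>S. f t \<partial>lborel)"
  using assms by (simp add: nn_integral_restrict_space nn_integral_completion)

lemma nn_integral_lborel_shift:
  fixes f :: "real \<Rightarrow> ennreal"
  assumes "f \<in> borel_measurable borel"
  shows "(\<integral>\<^sup>+ x. f x \<partial>lborel) = (\<integral>\<^sup>+ x. f (a + x) \<partial>lborel)"
  using nn_integral_real_affine[OF assms, of 1 a] by simp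

section \<open>Difference quotients of a controlled curve\<close>

text \<open>A shift turns the integral of \<open>F (t + h)\<close> into one over
  \<open>{h..1}\<close>. Compared with the integral over \<open>{0..1-h}\<close>, the excess is at
  most that over \<open>{1-h..1}\<close>, an interval of length \<open>h\<close> on which
  \<open>F\<close> is at most \<open>C\<close>.\<close>

lemma nn_integral_increment_le:
  fixes F :: "real \<Rightarrow> real"
  assumes F: "mono F" "\<And>t. 0 \<le> F t" "\<And>t. F t \<le> C" and h: "0 < h" "h < 1"
  shows "(\<integral>\<^sup>+ t\<in>{0..1-h}. ennreal (F (t + h) - F t) \<partial>lborel) \<le> ennreal (C * h)"
proof -
  have [measurable]: "F \<in> borel_measurable borel" using F(1) by (rule borel_measurable_mono)
  have C: "0 \<le> C" using F(2,3) order_trans by blast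
  let ?I = "\<integral>\<^sup>+ t\<in>{0..1-h}. ennreal (F t) \<partial>lborel"
  have "?I + (\<integral>\<^sup>+ t\<in>{0..1-h}. ennreal (F (t + h) - F t) \<partial>lborel)
      = (\<integral>\<^sup>+ t\<in>{0..1-h}. ennreal (F (h + t)) \<partial>lborel)"
    using F monoD[OF F(1), of t "t + h" for t] h
    by (subst nn_integral_add[symmetric])
       (auto intro!: nn_integral_cong simp: indicator_def add.commute simp flip: ennreal_plus)
  also have "\<dots> = (\<integral>\<^sup>+ t. ennreal (F (h + t)) * indicator {h..1} (h + t) \<partial>lborel)"
    by (intro nn_integral_cong) (auto simp: indicator_def)
  also have "\<dots> = (\<integral>\<^sup>+ t\<in>{h..1}. ennreal (F t) \<partial>lborel)"
    by (rule nn_integral_lborel_shift[symmetric]) measurable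
  also have "\<dots> \<le> (\<integral>\<^sup>+ t. ennreal (F t) * indicator {0..1-h} t + ennreal C * indicator {1-h..1} t \<partial>lborel)"
    using F h by (intro nn_integral_mono) (auto simp: indicator_def ennreal_leI)
  also have "\<dots> = ?I + ennreal C * emeasure lborel {1-h..1}"
    by (subst nn_integral_add) (auto simp: nn_integral_cmult_indicator)
  also have "\<dots> = ?I + ennreal (C * h)" using h C by (simp add: ennreal_mult)
  finally have *: "?I + (\<integral>\<^sup>+ t\<in>{0..1-h}. ennreal (F (t + h) - F t) \<partial>lborel) \<le> ?I + ennreal (C * h)" .
  \<comment> \<open>The common term \<open>?I\<close> can be cancelled in \<open>ennreal\<close>
    only because it is finite.\<close>
  have "?I \<le> (\<integral>\<^sup>+ t. ennreal C * indicator {0..1-h} t \<partial>lborel)"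
    using F by (intro nn_integral_mono) (auto simp: indicator_def ennreal_leI)
  also have "\<dots> < top" using h C by (simp add: nn_integral_cmult_indicator ennreal_mult_less_top)
  finally show ?thesis using * by (auto simp: ennreal_add_left_cancel_le)
qed

lemma difference_quotient_integral_le:
  fixes u :: "real \<Rightarrow> 'a::polish_space"
  assumes vu: "AE r in lebesgue. r \<in> {0..1} \<longrightarrow> v r = u r"
    and ctrl: "\<And>p q. p \<in> {0..1} \<Longrightarrow> q \<in> {0..1} \<Longrightarrow> p < q \<Longrightarrow> dist (v p) (v q) \<le> F q - F p"
    and F: "mono F" "\<And>t. 0 \<le> F t" "\<And>t. F t \<le> C" and h: "0 < h" "h < 1"
  shows "(\<integral>\<^sup>+ t. ennreal (dist (u (t + h)) (u t) / h) \<partial>lebesgue_on {0..1 - h}) \<le> ennreal C"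
proof -
  have [measurable]: "F \<in> borel_measurable borel" using F(1) by (rule borel_measurable_mono)
  have C: "0 \<le> C" using F(2,3) order_trans by blast
  have "AE t in lebesgue. t \<in> {0..1 - h} \<longrightarrow> dist (u (t + h)) (u t) \<le> F (t + h) - F t"
    using vu AE_lebesgue_translate[OF vu, of h]
  proof eventually_elim
    case (elim t)
    show ?case
    proof
      assume t: "t \<in> {0..1 - h}"
      then have "u t = v t" "u (t + h) = v (t + h)" using elim h by auto
      then show "dist (u (t + h)) (u t) \<le> F (t + h) - F t"
        using ctrl[of t "t + h"] t h by (simp add: dist_commute)
    qed
  qed
  then have "(\<integral>\<^sup>+ t. ennreal (dist (u (t + h)) (u t) / h) \<partial>lebesgue_on {0..1 - h})
      \<le> (\<integral>\<^sup>+ t. ennreal ((F (t + h) - F t) / h) \<partial>lebesgue_on {0..1 - h})"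
    using h by (intro nn_integral_mono_AE)
      (auto simp: AE_restrict_space_iff intro!: ennreal_leI divide_right_mono elim!: eventually_mono)
  also have "\<dots> = (\<integral>\<^sup>+ t\<in>{0..1-h}. ennreal ((F (t + h) - F t) / h) \<partial>lborel)"
    by (rule nn_integral_lebesgue_on_eq) simp
  also have "\<dots> = (\<integral>\<^sup>+ t. ennreal (1 / h) * (ennreal (F (t + h) - F t) * indicator {0..1-h} t) \<partial>lborel)"
    using h by (intro nn_integral_cong) (simp add: ennreal_mult'[symmetric] mult.assoc[symmetric])
  also have "\<dots> = ennreal (1 / h) * (\<integral>\<^sup>+ t\<in>{0..1-h}. ennreal (F (t + h) - F t) \<partial>lborel)"
    by (rule nn_integral_cmult) measurable
  also have "\<dots> \<le> ennreal (1 / h) * ennreal (C * h)"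
    by (intro mult_left_mono nn_integral_increment_le F h) simp
  also have "\<dots> = ennreal C" using h C by (simp add: ennreal_mult'[symmetric])
  finally show ?thesis .
qed

section \<open>Oscillation and grid estimates at scale \<open>h\<close>\<close>

text \<open>Not normalised: for \<open>t\<close> in the unit interval and \<open>0 < h < 1\<close>,
  division by \<open>h\<close> gives the mean oscillation up to a factor between 1 and 2.\<close>

definition local_osc :: "(real \<Rightarrow> 'a::metric_space) \<Rightarrow> real \<Rightarrow> real \<Rightarrow> ennreal" where
  "local_osc v h t = (\<integral>\<^sup>+ y\<in>{0..1} \<inter> {t-h..t+h}. ennreal (dist (v t) (v y)) \<partial>lborel)"

text \<open>Writing \<open>y = i * h + r\<close> with \<open>0 \<le> r < h\<close>, this is the
  integral over the offsets \<open>r\<close> of the variation of \<open>v\<close> along the grid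
  \<open>r, r + h, ..., r + m * h\<close>. Divided by \<open>h\<close> it is an average over the
  translates of the grid.\<close>

definition shift_cost :: "(real \<Rightarrow> 'a::metric_space) \<Rightarrow> real \<Rightarrow> nat \<Rightarrow> ennreal" where
  "shift_cost v h m = (\<integral>\<^sup>+ y\<in>{0..<real m * h}. ennreal (dist (v y) (v (y + h))) \<partial>lborel)"

context
  fixes v :: "real \<Rightarrow> 'a::polish_space" and C :: real
  assumes v_borel [measurable]: "v \<in> borel_measurable borel"
    and C_nonneg: "0 \<le> C"
    and quot: "\<And>h. 0 < h \<Longrightarrow> h < 1 \<Longrightarrow>
      (\<integral>\<^sup>+ t\<in>{0..1-h}. ennreal (dist (v (t + h)) (v t)) \<partial>lborel) \<le> ennreal (C * h)"
begin

lemma local_osc_measurable [measurable]: "local_osc v h \<in> borel_measurable borel"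
  unfolding local_osc_def indicator_def Int_iff atLeastAtMost_iff by measurable

text \<open>Replacing \<open>t\<close> by \<open>t - r\<close> exchanges the two points, which
  reduces a negative shift to a positive one.\<close>

lemma shift_integral_le:
  assumes "\<bar>r\<bar> < 1"
  shows "(\<integral>\<^sup>+ t. ennreal (dist (v t) (v (t + r))) * indicator {0..1} t * indicator {0..1} (t + r) \<partial>lborel)
           \<le> ennreal (C * \<bar>r\<bar>)"
proof -
  consider "r = 0" | "0 < r" | "r < 0" by linarith
  then show ?thesis
  proof cases
    case 2
    have "(\<integral>\<^sup>+ t. ennreal (dist (v t) (v (t + r))) * indicator {0..1} t * indicator {0..1} (t + r) \<partial>lborel)
        = (\<integral>\<^sup>+ t\<in>{0..1-r}. ennreal (dist (v (t + r)) (v t)) \<partial>lborel)"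
      using 2 by (intro nn_integral_cong) (auto simp: indicator_def dist_commute)
    then show ?thesis using quot[of r] 2 assms by simp
  next
    case 3
    have "(\<integral>\<^sup>+ t. ennreal (dist (v t) (v (t + r))) * indicator {0..1} t * indicator {0..1} (t + r) \<partial>lborel)
        = (\<integral>\<^sup>+ t. ennreal (dist (v (- r + t)) (v (- r + t + r))) * indicator {0..1} (- r + t) *
            indicator {0..1} (- r + t + r) \<partial>lborel)"
      by (rule nn_integral_lborel_shift) measurable
    also have "\<dots> = (\<integral>\<^sup>+ t\<in>{0..1-(-r)}. ennreal (dist (v (t + - r)) (v t)) \<partial>lborel)"
      using 3 by (intro nn_integral_cong) (auto simp: indicator_def)
    finally show ?thesis using quot[of "- r"] 3 assms by simp
  qed simp
qed

text \<open>Tonelli moves the offset \<open>r\<close> to the outer integral. Each offset contributes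
  at most \<open>C * h\<close>, and the offsets fill an interval of length
  \<open>2 * h\<close>.\<close>

lemma local_osc_integral_le:
  assumes h: "0 < h" "h < 1"
  shows "(\<integral>\<^sup>+ t\<in>{0..1}. local_osc v h t \<partial>lborel) \<le> ennreal (2 * C * h * h)"
proof -
  let ?d = "\<lambda>t r. ennreal (dist (v t) (v (t + r))) * indicator {0..1} t * indicator {0..1} (t + r)"
  have "local_osc v h t * indicator {0..1} t = (\<integral>\<^sup>+ r. ?d t r * indicator {-h..h} r \<partial>lborel)" for t
  proof -
    have *: "local_osc v h t = (\<integral>\<^sup>+ r. ennreal (dist (v t) (v (t + r))) *
        indicator ({0..1} \<inter> {t-h..t+h}) (t + r) \<partial>lborel)"
      unfolding local_osc_def by (rule nn_integral_lborel_shift) measurable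
    have "local_osc v h t * indicator {0..1} t = (\<integral>\<^sup>+ r. ennreal (dist (v t) (v (t + r))) *
        indicator ({0..1} \<inter> {t-h..t+h}) (t + r) * indicator {0..1} t \<partial>lborel)"
      unfolding * by (rule nn_integral_multc[symmetric]) measurable
    also have "\<dots> = (\<integral>\<^sup>+ r. ?d t r * indicator {-h..h} r \<partial>lborel)"
      by (intro nn_integral_cong) (auto simp: indicator_def)
    finally show ?thesis .
  qed
  then have "(\<integral>\<^sup>+ t\<in>{0..1}. local_osc v h t \<partial>lborel)
      = (\<integral>\<^sup>+ t. \<integral>\<^sup>+ r. ?d t r * indicator {-h..h} r \<partial>lborel \<partial>lborel)" by simp
  also have "\<dots> = (\<integral>\<^sup>+ r. \<integral>\<^sup>+ t. ?d t r * indicator {-h..h} r \<partial>lborel \<partial>lborel)"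
    by (rule lborel_pair.Fubini'[symmetric]) measurable
  also have "\<dots> = (\<integral>\<^sup>+ r. (\<integral>\<^sup>+ t. ?d t r \<partial>lborel) * indicator {-h..h} r \<partial>lborel)"
    by (intro nn_integral_cong nn_integral_multc) measurable
  also have "\<dots> \<le> (\<integral>\<^sup>+ r. ennreal (C * h) * indicator {-h..h} r \<partial>lborel)"
  proof (intro nn_integral_mono)
    fix r
    show "(\<integral>\<^sup>+ t. ?d t r \<partial>lborel) * indicator {-h..h} r \<le> ennreal (C * h) * indicator {-h..h} r"
    proof (cases "r \<in> {-h..h}")
      case True
      then have r: "\<bar>r\<bar> \<le> h" by auto
      have "(\<integral>\<^sup>+ t. ?d t r \<partial>lborel) \<le> ennreal (C * \<bar>r\<bar>)"
        using r h by (intro shift_integral_le) auto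
      also have "\<dots> \<le> ennreal (C * h)" using r C_nonneg by (intro ennreal_leI mult_left_mono)
      finally show ?thesis using True by simp
    qed simp
  qed
  also have "\<dots> = ennreal (C * h) * emeasure lborel {-h..h}"
    by (rule nn_integral_cmult_indicator) simp
  also have "\<dots> = ennreal (2 * C * h * h)"
    using h C_nonneg by (simp add: ennreal_mult'[symmetric] mult_ac)
  finally show ?thesis .
qed

text \<open>After division by the scale the integrals are of the order of the scale itself, hence
  summable. So the series over \<open>n\<close> is finite at almost every point, and its terms tend
  to \<open>0\<close>.\<close>

lemma AE_local_osc_tendsto_0:
  "AE t in lborel. t \<in> {0..1} \<longrightarrow>
     (\<forall>n. local_osc v ((1/2)^Suc n) t < \<infinity>) \<and>
     (\<lambda>n. enn2real (local_osc v ((1/2)^Suc n) t) / (1/2)^Suc n) \<longlonglongrightarrow> 0"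
proof -
  \<comment> \<open>The exponent \<open>Suc n\<close> keeps the scale below \<open>1\<close> already
    for \<open>n = 0\<close>.\<close>
  let ?h = "\<lambda>n. (1/2::real)^Suc n"
  let ?g = "\<lambda>n t. ennreal (1 / ?h n) * (local_osc v (?h n) t * indicator {0..1} t)"
  have h: "0 < ?h n" "?h n < 1" for n by (simp, rule power_Suc_less_one) auto
  have "(\<integral>\<^sup>+ t. (\<Sum>n. ?g n t) \<partial>lborel) = (\<Sum>n. \<integral>\<^sup>+ t. ?g n t \<partial>lborel)"
    by (rule nn_integral_suminf) measurable
  also have "\<dots> \<le> (\<Sum>n. ennreal (2 * C * ?h n))"
  proof (rule suminf_le)
    fix n
    have "(\<integral>\<^sup>+ t. ?g n t \<partial>lborel) = ennreal (1 / ?h n) * (\<integral>\<^sup>+ t\<in>{0..1}. local_osc v (?h n) t \<partial>lborel)"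
      by (rule nn_integral_cmult) measurable
    also have "\<dots> \<le> ennreal (1 / ?h n) * ennreal (2 * C * ?h n * ?h n)"
      by (intro mult_left_mono local_osc_integral_le h) simp
    also have "\<dots> = ennreal (2 * C * ?h n)"
      using h[of n] by (simp add: ennreal_mult'[symmetric])
    finally show "(\<integral>\<^sup>+ t. ?g n t \<partial>lborel) \<le> ennreal (2 * C * ?h n)" .
  qed auto
  also have "\<dots> < \<infinity>"
  proof -
    have "summable (\<lambda>n. 2 * C * ?h n)" by (intro summable_mult summable_Suc_iff[THEN iffD2] summable_geometric) simp
    then show ?thesis using C_nonneg h by (subst suminf_ennreal2) (auto simp: less_imp_le)
  qed
  finally have "AE t in lborel. (\<Sum>n. ?g n t) \<noteq> \<infinity>"
    by (intro nn_integral_noteq_infinite) auto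
  then show ?thesis
  proof eventually_elim
    case (elim t)
    show ?case
    proof
      assume t: "t \<in> {0..1}"
      have gt: "?g n t = ennreal (1 / ?h n) * local_osc v (?h n) t" for n using t by simp
      have gfin: "?g n t < \<infinity>" for n
        using elim ennreal_suminf_lessD[of "\<lambda>n. ?g n t" top n] by (simp add: less_top)
      have fin: "local_osc v (?h n) t < \<infinity>" for n
        using gfin[of n] h[of n] unfolding gt
        by (cases "local_osc v (?h n) t = 0") (auto simp: ennreal_mult_less_top)
      have g: "?g n t = ennreal (enn2real (local_osc v (?h n) t) / ?h n)" for n
      proof -
        have "local_osc v (?h n) t = ennreal (enn2real (local_osc v (?h n) t))"
          using fin[of n] by (simp del: power_Suc)
        then have "?g n t = ennreal (1 / ?h n) * ennreal (enn2real (local_osc v (?h n) t))"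
          unfolding gt by (rule arg_cong)
        also have "\<dots> = ennreal (enn2real (local_osc v (?h n) t) / ?h n)"
          using h(1)[of n] by (simp add: ennreal_mult'[symmetric] del: power_Suc)
        finally show ?thesis .
      qed
      have "summable (\<lambda>n. enn2real (local_osc v (?h n) t) / ?h n)"
        by (rule summable_suminf_not_top)
          (use elim in \<open>simp_all only: g infinity_ennreal_def\<close>, simp_all)
      then show "(\<forall>n. local_osc v (?h n) t < \<infinity>) \<and>
          (\<lambda>n. enn2real (local_osc v (?h n) t) / ?h n) \<longlonglongrightarrow> 0"
        using fin summable_LIMSEQ_zero by blast
    qed
  qed
qed

lemma shift_cost_le:
  assumes "0 < h" "h < 1" "real m * h + h \<le> 1"
  shows "shift_cost v h m \<le> ennreal (C * h)"
proof -
  have "shift_cost v h m \<le> (\<integral>\<^sup>+ t\<in>{0..1-h}. ennreal (dist (v (t + h)) (v t)) \<partial>lborel)"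
    unfolding shift_cost_def using assms
    by (intro nn_integral_mono) (auto simp: indicator_def dist_commute)
  also have "\<dots> \<le> ennreal (C * h)" using assms by (intro quot)
  finally show ?thesis .
qed

text \<open>Passing from \<open>k\<close> to \<open>Suc k\<close> enlarges \<open>shift_cost\<close>
  by exactly one cell integral, and by the triangle inequality the integral on the left grows by at
  most the same amount. The form as a sum avoids subtraction in \<open>ennreal\<close>.\<close>

lemma grid_integral_le:
  assumes h: "0 < h" and "m \<le> k"
  shows "(\<integral>\<^sup>+ r\<in>{0..<h}. ennreal (dist (v (real m * h + r)) (v (real k * h + r))) \<partial>lborel)
           + shift_cost v h m \<le> shift_cost v h k"
  using \<open>m \<le> k\<close>
proof (induction k rule: dec_induct)
  case (step k)
  let ?J = "\<lambda>k. \<integral>\<^sup>+ r\<in>{0..<h}. ennreal (dist (v (real m * h + r)) (v (real k * h + r))) \<partial>lborel"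
  let ?K = "\<integral>\<^sup>+ r\<in>{0..<h}. ennreal (dist (v (real k * h + r)) (v (real (Suc k) * h + r))) \<partial>lborel"
  have "?J (Suc k) \<le> (\<integral>\<^sup>+ r. ennreal (dist (v (real m * h + r)) (v (real k * h + r))) * indicator {0..<h} r
      + ennreal (dist (v (real k * h + r)) (v (real (Suc k) * h + r))) * indicator {0..<h} r \<partial>lborel)"
    by (intro nn_integral_mono)
       (auto simp: indicator_def dist_triangle intro!: ennreal_leI simp flip: ennreal_plus)
  also have "\<dots> = ?J k + ?K" by (rule nn_integral_add) measurable
  finally have J: "?J (Suc k) \<le> ?J k + ?K" .
  have "?K = (\<integral>\<^sup>+ r. ennreal (dist (v (real k * h + r)) (v (real k * h + r + h)))
      * indicator {real k * h..<real (Suc k) * h} (real k * h + r) \<partial>lborel)"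
    by (intro nn_integral_cong) (auto simp: indicator_def algebra_simps)
  also have "\<dots> = (\<integral>\<^sup>+ y\<in>{real k * h..<real (Suc k) * h}. ennreal (dist (v y) (v (y + h))) \<partial>lborel)"
    by (rule nn_integral_lborel_shift[symmetric]) measurable
  finally have K: "?K = (\<integral>\<^sup>+ y\<in>{real k * h..<real (Suc k) * h}. ennreal (dist (v y) (v (y + h))) \<partial>lborel)" .
  have "shift_cost v h (Suc k) = (\<integral>\<^sup>+ y. ennreal (dist (v y) (v (y + h))) * indicator {0..<real k * h} y
      + ennreal (dist (v y) (v (y + h))) * indicator {real k * h..<real (Suc k) * h} y \<partial>lborel)"
    unfolding shift_cost_def using h
    by (intro nn_integral_cong) (auto simp: indicator_def algebra_simps intro: order_trans[rotated])
  also have "\<dots> = shift_cost v h k + ?K"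
    unfolding K shift_cost_def by (rule nn_integral_add) measurable
  finally have cost: "shift_cost v h (Suc k) = shift_cost v h k + ?K" .
  have "?J (Suc k) + shift_cost v h m \<le> (?J k + shift_cost v h m) + ?K"
    using add_right_mono[OF J, of "shift_cost v h m"] by (simp add: ac_simps)
  also have "\<dots> \<le> shift_cost v h k + ?K" using step.IH by (rule add_right_mono)
  finally show ?case unfolding cost .
qed simp

text \<open>The cell of length \<open>h\<close> containing \<open>t\<close> lies within distance
  \<open>h\<close> of \<open>t\<close>, and the last assumption keeps it inside the unit
  interval.\<close>

lemma average_le_local_osc:
  assumes h: "0 < h" "h < 1" and t: "real m * h \<le> t" "t < real m * h + h" "real m * h + h \<le> 1"
  shows "(\<integral>\<^sup>+ r\<in>{0..<h}. ennreal (dist (v t) (v (real m * h + r))) \<partial>lborel) \<le> local_osc v h t"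
proof -
  have "(\<integral>\<^sup>+ r\<in>{0..<h}. ennreal (dist (v t) (v (real m * h + r))) \<partial>lborel)
      = (\<integral>\<^sup>+ r. ennreal (dist (v t) (v (real m * h + r))) *
          indicator {real m * h..<real m * h + h} (real m * h + r) \<partial>lborel)"
    by (intro nn_integral_cong) (auto simp: indicator_def)
  also have "\<dots> = (\<integral>\<^sup>+ y\<in>{real m * h..<real m * h + h}. ennreal (dist (v t) (v y)) \<partial>lborel)"
    by (rule nn_integral_lborel_shift[symmetric]) measurable
  also have "\<dots> \<le> local_osc v h t"
    unfolding local_osc_def using h t
    by (intro nn_integral_mono) (auto simp: indicator_def intro: order_trans[rotated])
  finally show ?thesis .
qed

text \<open>For each offset \<open>r\<close> the triangle inequality runs from \<open>v s\<close>
  through the points of offset \<open>r\<close> in the two cells to \<open>v t\<close>. Integration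
  over \<open>{0..<h}\<close> gives the factor \<open>h\<close>; the outer legs are local
  oscillations, the middle leg is the grid integral.\<close>

lemma dist_le_local_osc_shift_cost:
  assumes h: "0 < h" "h < 1" and m: "m \<le> k"
    and s: "real m * h \<le> s" "s < real m * h + h" and t: "real k * h \<le> t" "t < real k * h + h"
    and k: "real k * h + h \<le> 1"
  shows "ennreal (dist (v s) (v t) * h) + shift_cost v h m
           \<le> local_osc v h s + local_osc v h t + shift_cost v h k"
proof -
  let ?a = "\<lambda>r. ennreal (dist (v s) (v (real m * h + r))) * indicator {0..<h} r"
  let ?b = "\<lambda>r. ennreal (dist (v (real m * h + r)) (v (real k * h + r))) * indicator {0..<h} r"
  let ?c = "\<lambda>r. ennreal (dist (v t) (v (real k * h + r))) * indicator {0..<h} r"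
  have "real m * h \<le> real k * h" using m h by (intro mult_right_mono) auto
  with k have m1: "real m * h + h \<le> 1" by simp
  have "ennreal (dist (v s) (v t) * h) = (\<integral>\<^sup>+ r. ennreal (dist (v s) (v t)) * indicator {0..<h} r \<partial>lborel)"
    using h by (simp add: nn_integral_cmult_indicator ennreal_mult)
  also have "\<dots> \<le> (\<integral>\<^sup>+ r. ?a r + ?b r + ?c r \<partial>lborel)"
  proof (intro nn_integral_mono)
    fix r
    have "dist (v s) (v t) \<le> dist (v s) (v (real m * h + r)) +
        dist (v (real m * h + r)) (v (real k * h + r)) + dist (v t) (v (real k * h + r))"
      using dist_triangle[of "v s" "v t" "v (real m * h + r)"]
        dist_triangle2[of "v (real m * h + r)" "v t" "v (real k * h + r)"] by linarith
    then show "ennreal (dist (v s) (v t)) * indicator {0..<h} r \<le> ?a r + ?b r + ?c r"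
      by (auto simp: indicator_def intro!: ennreal_leI simp flip: ennreal_plus)
  qed
  also have "\<dots> = (\<integral>\<^sup>+ r. ?a r \<partial>lborel) + (\<integral>\<^sup>+ r. ?b r \<partial>lborel) + (\<integral>\<^sup>+ r. ?c r \<partial>lborel)"
    by (simp add: nn_integral_add)
  finally have "ennreal (dist (v s) (v t) * h) + shift_cost v h m
      \<le> (\<integral>\<^sup>+ r. ?a r \<partial>lborel) + (\<integral>\<^sup>+ r. ?c r \<partial>lborel) + ((\<integral>\<^sup>+ r. ?b r \<partial>lborel) + shift_cost v h m)"
    by (simp add: ac_simps add_left_mono add_right_mono)
  also have "\<dots> \<le> local_osc v h s + local_osc v h t + shift_cost v h k"
    using average_le_local_osc[OF h s m1] average_le_local_osc[OF h t k] grid_integral_le[OF h(1) m]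
    by (intro add_mono)
  finally show ?thesis .
qed

lemma ess_Var_finite_of_difference_quotient: "ess_Var v {0..1} < \<infinity>"
proof -
  let ?h = "\<lambda>n. (1/2::real)^Suc n"
  define e where "e n t = enn2real (local_osc v (?h n) t) / ?h n" for n t
  define m where "m n t = nat \<lfloor>t / ?h n\<rfloor>" for n t
  \<comment> \<open>The grid variation up to the cell of \<open>t\<close>, averaged over the
    offsets; on \<open>{0..<1}\<close> it stays in \<open>{0..C}\<close> uniformly in
    \<open>n\<close>.\<close>
  define F where "F n t = enn2real (shift_cost v (?h n) (m n t)) / ?h n" for n t
  \<comment> \<open>The point \<open>1\<close> is left out because its cell would reach beyond the
    unit interval.\<close>
  define G where "G = {t \<in> {0..<1}. (\<forall>n. local_osc v (?h n) t < \<infinity>) \<and> (\<lambda>n. e n t) \<longlonglongrightarrow> 0}"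
  have h: "0 < ?h n" "?h n < 1" for n by (simp, rule power_Suc_less_one) auto
  have m: "real (m n t) * ?h n \<le> t" "t < real (m n t) * ?h n + ?h n" "real (m n t) * ?h n + ?h n \<le> 1"
    if t: "t \<in> {0..<1}" for n t
  proof -
    have rm: "real (m n t) = of_int \<lfloor>t / ?h n\<rfloor>" using t h[of n] by (simp add: m_def)
    have "real (m n t) \<le> t / ?h n" "t / ?h n < real (m n t) + 1" unfolding rm by linarith+
    then show le: "real (m n t) * ?h n \<le> t" and "t < real (m n t) * ?h n + ?h n"
      using h[of n] by (simp_all add: field_simps del: power_Suc)
    \<comment> \<open>The scale divides \<open>1\<close> exactly, so the cells tile
      \<open>{0..<1}\<close> and the last one ends at \<open>1\<close>.\<close>
    have inv: "2 ^ Suc n * ?h n = 1" by (simp add: power_mult_distrib[symmetric] del: power_Suc)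
    have "real (m n t) * ?h n < 2 ^ Suc n * ?h n" unfolding inv using le t by simp
    then have "real (m n t) < real (2 ^ Suc n)" using h[of n] by (simp add: mult_less_cancel_right del: power_Suc)
    then have "m n t + 1 \<le> 2 ^ Suc n" unfolding of_nat_less_iff by simp
    then have "real (m n t + 1) \<le> real (2 ^ Suc n)" unfolding of_nat_le_iff .
    then have "(real (m n t) + 1) * ?h n \<le> 2 ^ Suc n * ?h n"
      using h[of n] by (intro mult_right_mono) auto
    then show "real (m n t) * ?h n + ?h n \<le> 1" unfolding inv by (simp add: algebra_simps)
  qed
  have cost_fin: "shift_cost v (?h n) (m n t) \<le> ennreal (C * ?h n)" if "t \<in> {0..<1}" for n t
    using m[OF that] h by (intro shift_cost_le)
  have F_le: "F n t \<le> C" if "t \<in> {0..<1}" for n t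
  proof -
    have "enn2real (shift_cost v (?h n) (m n t)) \<le> C * ?h n"
      using cost_fin[OF that] h[of n] C_nonneg by (intro enn2real_leI) auto
    then show ?thesis using h[of n] by (simp add: F_def divide_le_eq del: power_Suc)
  qed
  have F_nonneg: "0 \<le> F n t" for n t using h[of n] by (simp add: F_def)
  have step: "dist (v s) (v t) \<le> e n s + e n t + (F n t - F n s)"
    if st: "s \<in> G" "t \<in> G" "s < t" for n s t
  proof -
    have s01: "s \<in> {0..<1}" and t01: "t \<in> {0..<1}" using st by (auto simp: G_def)
    have "m n s \<le> m n t"
      unfolding m_def using st h[of n] by (intro nat_mono floor_mono divide_right_mono) auto
    from dist_le_local_osc_shift_cost[OF h this m(1,2)[OF s01] m(1-3)[OF t01]]
    have "ennreal (dist (v s) (v t) * ?h n) + shift_cost v (?h n) (m n s)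
      \<le> local_osc v (?h n) s + local_osc v (?h n) t + shift_cost v (?h n) (m n t)" .
    moreover have "local_osc v (?h n) s = ennreal (e n s * ?h n)" "local_osc v (?h n) t = ennreal (e n t * ?h n)"
      using st h[of n] by (auto simp: G_def e_def)
    moreover have "shift_cost v (?h n) (m n s) = ennreal (F n s * ?h n)"
        "shift_cost v (?h n) (m n t) = ennreal (F n t * ?h n)"
      using le_less_trans[OF cost_fin[OF s01] ennreal_less_top]
        le_less_trans[OF cost_fin[OF t01] ennreal_less_top] h[of n] by (auto simp: F_def)
    moreover have "0 \<le> e n x" for x using h[of n] by (simp add: e_def)
    ultimately have "ennreal (dist (v s) (v t) * ?h n + F n s * ?h n)
        \<le> ennreal (e n s * ?h n + e n t * ?h n + F n t * ?h n)"
      using h[of n] F_nonneg by (simp add: less_imp_le)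
    moreover have "0 \<le> e n s * ?h n + e n t * ?h n + F n t * ?h n"
      using h[of n] F_nonneg \<open>\<And>x. 0 \<le> e n x\<close> by (simp add: less_imp_le)
    ultimately have "dist (v s) (v t) * ?h n + F n s * ?h n \<le> e n s * ?h n + e n t * ?h n + F n t * ?h n"
      by (simp only: ennreal_le_iff)
    then have "(dist (v s) (v t) + F n s) * ?h n \<le> (e n s + e n t + F n t) * ?h n"
      by (simp only: distrib_right)
    then have "dist (v s) (v t) + F n s \<le> e n s + e n t + F n t"
      using h(1) by (rule mult_right_le_imp_le)
    then show ?thesis by linarith
  qed
  have "Var v G \<le> ennreal C"
  proof (rule Var_least, rule ennreal_leI)
    fix t :: "nat \<Rightarrow> real" and k
    assume t: "\<And>i. i \<le> k \<Longrightarrow> t i < t (Suc i)" "\<And>i. i \<le> Suc k \<Longrightarrow> t i \<in> G"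
    let ?S = "\<Sum>i=0..k. dist (v (t i)) (v (t (Suc i)))"
    \<comment> \<open>For a fixed partition the increments of \<open>F n\<close> telescope to at
      most \<open>C\<close>. Finitely many error terms remain, and they vanish as \<open>n\<close>
      grows.\<close>
    have "?S \<le> (\<Sum>i=0..k. e n (t i) + e n (t (Suc i))) + C" for n
    proof -
      have "?S \<le> (\<Sum>i=0..k. e n (t i) + e n (t (Suc i)) + (F n (t (Suc i)) - F n (t i)))"
        by (intro sum_mono step) (use t in auto)
      also have "\<dots> = (\<Sum>i=0..k. e n (t i) + e n (t (Suc i))) + (F n (t (Suc k)) - F n (t 0))"
        unfolding sum.distrib by (subst sum_Suc_diff) auto
      also have "F n (t (Suc k)) - F n (t 0) \<le> C"
        using F_le[of "t (Suc k)" n] F_nonneg[of n "t 0"] t(2)[of "Suc k"] by (auto simp: G_def)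
      finally show ?thesis by simp
    qed
    moreover have "(\<lambda>n. (\<Sum>i=0..k. e n (t i) + e n (t (Suc i))) + C) \<longlonglongrightarrow> (\<Sum>i=0..k. 0 + 0) + C"
      by (intro tendsto_add tendsto_sum tendsto_const) (use t(2) in \<open>auto simp: G_def\<close>)
    ultimately show "?S \<le> C" by (intro LIMSEQ_le_const) auto
  qed
  then have fin: "Var v G < \<infinity>" by (rule le_less_trans) simp
  \<comment> \<open>The cumulative variation of \<open>v\<close> on \<open>G\<close> is a control
    function free of error terms, so the extension from \<open>G\<close> applies.\<close>
  show ?thesis
  proof (rule ess_Var_finite[where G=G and F="\<lambda>r. enn2real (Var v (G \<inter> {..r}))"
        and C="enn2real (Var v G)"])
    have "AE t in lebesgue. t \<noteq> (1::real)" by (simp add: AE_completion_iff AE_lborel_singleton)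
    moreover have "AE t in lebesgue. t \<in> {0..1} \<longrightarrow> (\<forall>n. local_osc v (?h n) t < \<infinity>) \<and> (\<lambda>n. e n t) \<longlonglongrightarrow> 0"
      using AE_local_osc_tendsto_0 unfolding AE_completion_iff e_def .
    ultimately show "AE t in lebesgue. t \<in> {0..1} \<longrightarrow> t \<in> G"
      by eventually_elim (auto simp: G_def)
    show "G \<subseteq> {0..1}" by (auto simp: G_def)
  qed (use Var_control[OF fin] in auto)
qed

end

section \<open>Transfer between a curve and its Borel representative\<close>

text \<open>Translates of null sets are null, so \<open>v\<close> and \<open>u\<close> agree at both
  \<open>t\<close> and \<open>t + h\<close> for almost every \<open>t\<close>.\<close>

lemma borel_representative_quotient_le:
  fixes u v :: "real \<Rightarrow> 'a::polish_space"
  assumes vu: "AE t in lebesgue. t \<in> {0..1} \<longrightarrow> v t = u t"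
    and v [measurable]: "v \<in> borel_measurable borel"
    and C: "0 \<le> C" and h: "0 < h" "h < 1"
    and le: "(\<integral>\<^sup>+ t. ennreal (dist (u (t + h)) (u t) / h) \<partial>lebesgue_on {0..1 - h}) \<le> ennreal C"
  shows "(\<integral>\<^sup>+ t\<in>{0..1-h}. ennreal (dist (v (t + h)) (v t)) \<partial>lborel) \<le> ennreal (C * h)"
proof -
  have "AE t in lebesgue. t \<in> {0..1 - h} \<longrightarrow> dist (v (t + h)) (v t) = dist (u (t + h)) (u t)"
    using vu AE_lebesgue_translate[OF vu, of h] by eventually_elim (use h in auto)
  then have "(\<integral>\<^sup>+ t. ennreal (dist (v (t + h)) (v t) / h) \<partial>lebesgue_on {0..1 - h})
      = (\<integral>\<^sup>+ t. ennreal (dist (u (t + h)) (u t) / h) \<partial>lebesgue_on {0..1 - h})"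
    using h by (intro nn_integral_cong_AE) (auto simp: AE_restrict_space_iff elim!: eventually_mono)
  with le have le': "(\<integral>\<^sup>+ t\<in>{0..1-h}. ennreal (dist (v (t + h)) (v t) / h) \<partial>lborel) \<le> ennreal C"
    by (simp add: nn_integral_lebesgue_on_eq)
  have "(\<integral>\<^sup>+ t\<in>{0..1-h}. ennreal (dist (v (t + h)) (v t)) \<partial>lborel)
      = (\<integral>\<^sup>+ t. ennreal h * (ennreal (dist (v (t + h)) (v t) / h) * indicator {0..1-h} t) \<partial>lborel)"
    using h by (intro nn_integral_cong) (simp add: ennreal_mult'[symmetric] mult.assoc[symmetric])
  also have "\<dots> = ennreal h * (\<integral>\<^sup>+ t\<in>{0..1-h}. ennreal (dist (v (t + h)) (v t) / h) \<partial>lborel)"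
    by (rule nn_integral_cmult) measurable
  also have "\<dots> \<le> ennreal h * ennreal C" using le' by (rule mult_left_mono) simp
  also have "\<dots> = ennreal (C * h)" using h C by (simp add: ennreal_mult mult.commute)
  finally show ?thesis .
qed

lemma BV_curve_iff_difference_quotient_bounded:
  fixes u :: "real \<Rightarrow> 'a::polish_space"
  assumes u: "u \<in> L1_I"
  shows "BV_curve u \<longleftrightarrow>
    (SUP h\<in>{0<..<1}. \<integral>\<^sup>+ t. ennreal (dist (u (t + h)) (u t) / h) \<partial>lebesgue_on {0..1 - h}) < \<infinity>"
    (is "_ \<longleftrightarrow> (SUP h\<in>_. ?I h) < \<infinity>")
proof
  assume "BV_curve u"
  then obtain v and F :: "real \<Rightarrow> real" and C :: real
    where v: "AE r in lebesgue. r \<in> {0..1} \<longrightarrow> v r = u r"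
      and ctrl: "\<And>p q. p \<in> {0..1} \<Longrightarrow> q \<in> {0..1} \<Longrightarrow> p < q \<Longrightarrow> dist (v p) (v q) \<le> F q - F p"
      and F: "mono F" "\<And>t. 0 \<le> F t" "\<And>t. F t \<le> C"
    by (rule BV_curve_obtain) blast
  have "(SUP h\<in>{0<..<1}. ?I h) \<le> ennreal C"
    by (intro SUP_least difference_quotient_integral_le[OF v ctrl F]) auto
  then show "(SUP h\<in>{0<..<1}. ?I h) < \<infinity>" by (rule le_less_trans) simp
next
  assume "(SUP h\<in>{0<..<1}. ?I h) < \<infinity>"
  then obtain C where C: "0 \<le> C" "(SUP h\<in>{0<..<1}. ?I h) = ennreal C"
    by (cases "SUP h\<in>{0<..<1}. ?I h") auto
  have le: "?I h \<le> ennreal C" if "0 < h" "h < 1" for h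
    unfolding C(2)[symmetric] by (rule SUP_upper) (use that in auto)
  obtain v where v: "v \<in> borel_measurable borel" and vu: "AE t in lebesgue. t \<in> {0..1} \<longrightarrow> v t = u t"
    using u by (rule L1_I_borel_representative)
  have "ess_Var v {0..1} < \<infinity>"
    using borel_representative_quotient_le[OF vu v C(1) _ _ le]
    by (intro ess_Var_finite_of_difference_quotient[OF v C(1)]) auto
  \<comment> \<open>A representative of \<open>v\<close> of finite variation also represents
    \<open>u\<close>.\<close>
  then obtain w where "AE t in lebesgue. t \<in> {0..1} \<longrightarrow> w t = v t" and w: "Var w {0..1} < \<infinity>"
    by (auto simp: ess_Var_def Inf_less_iff)
  with vu have "AE t in lebesgue. t \<in> {0..1} \<longrightarrow> w t = u t"
    by (auto elim: eventually_elim2)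
  from le_less_trans[OF ess_Var_le_Var[OF this] w] u show "BV_curve u"
    by (simp add: BV_curve_def)
qed

section \<open>The cycle of implications\<close>

theorem theorem2p17:
  fixes u :: "real \<Rightarrow> 'a::polish_space"
  assumes "u \<in> L1_I"
  shows
    "(BV_curve u \<longleftrightarrow>
        (SUP h\<in>{0<..<1}. \<integral>\<^sup>+ t. ennreal (dist (u (t + h)) (u t) / h) \<partial>lebesgue_on {0..1 - h}) < \<infinity>)
     \<and> (BV_curve u \<longleftrightarrow>
        (\<exists>\<mu>\<in>finite_borel_measures_I. \<forall>\<phi> :: 'a \<Rightarrow> real. 1-lipschitz_on UNIV \<phi> \<longrightarrow>
           BV_curve (\<phi> \<circ> u) \<and> variation_le (\<phi> \<circ> u) \<mu>))
     \<and> (BV_curve u \<longleftrightarrow>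
        (\<exists>\<mu>\<in>finite_borel_measures_I. \<forall>x :: 'a.
           BV_curve ((\<lambda>y. dist y x) \<circ> u) \<and> variation_le ((\<lambda>y. dist y x) \<circ> u) \<mu>))
     \<and> (BV_curve u \<longleftrightarrow>
        (\<exists>\<mu>\<in>finite_borel_measures_I. AE (s, t) in lebesgue_on ({0..1} \<times> {0..1}).
           dist (u t) (u s) \<le> measure \<mu> (closed_segment s t)))"
proof -
  let ?three = "\<exists>\<mu>\<in>finite_borel_measures_I. \<forall>\<phi> :: 'a \<Rightarrow> real. 1-lipschitz_on UNIV \<phi> \<longrightarrow>
      BV_curve (\<phi> \<circ> u) \<and> variation_le (\<phi> \<circ> u) \<mu>"
  let ?four = "\<exists>\<mu>\<in>finite_borel_measures_I. \<forall>x :: 'a.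
      BV_curve ((\<lambda>y. dist y x) \<circ> u) \<and> variation_le ((\<lambda>y. dist y x) \<circ> u) \<mu>"
  let ?five = "\<exists>\<mu>\<in>finite_borel_measures_I. AE (s, t) in lebesgue_on ({0..1} \<times> {0..1}).
      dist (u t) (u s) \<le> measure \<mu> (closed_segment s t)"
  have 13: "BV_curve u \<Longrightarrow> ?three" by (rule BV_curve_imp_lipschitz_dominated)
  have 34: "?three \<Longrightarrow> ?four" using lipschitz_on_dist_left by blast
  have 45: "?four \<Longrightarrow> ?five" using distance_functions_dominated_imp_AE_dist_le[of _ u] by blast
  have 51: "?five \<Longrightarrow> BV_curve u" using AE_dist_le_imp_BV_curve[OF assms] by blast
  have "BV_curve u \<longleftrightarrow> ?three" "BV_curve u \<longleftrightarrow> ?four" "BV_curve u \<longleftrightarrow> ?five"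
    using 13 34 45 51 by argo+
  with BV_curve_iff_difference_quotient_bounded[OF assms] show ?thesis by (intro conjI)
qed

end
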